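(* Let $\mathbb G$ be a homogeneous group, let $d$ be a homogeneous distance on $\mathbb G$ whose closed metric unit ball $\mathbb B=\mathbb B(0,1)$ is convex, and let $N\subset\mathbb G$ be an $n$-dimensional vertical subgroup, $n\ge1$. Then $$\beta_d(N)=\mathcal H^n_{|\cdot|}(N\cap\mathbb B).$$
   Context: A homogeneous group is a finite dimensional real vector space $\mathbb G=H^1\oplus\cdots\oplus H^\iota$, $H^\iota\neq\{0\}$, with a nilpotent Lie bracket satisfying $[H^i,H^j]\subset H^{i+j}$ ($H^k=\{0\}$ for $k>\iota$), with group law given by the Baker-Campbell-Hausdorff formula $xy=x+y+\frac12[x,y]+\cdots$ (so the identity is $0$ and $x^{-1}=-x$), and with the linear dilations $\delta_r$, $r>0$, $\delta_r x=r^ix$ for $x\in H^i$. A scalar product on $\mathbb G$ making the $H^j$ mutually orthogonal is fixed, with norm $|\cdot|$. A homogeneous distance $d$ is a left invariant distance with $d(\delta_rx,\delta_ry)=r\,d(x,y)$; $\mathbb B(x,r)$ denotes the closed $d$-ball. Convexity refers to the linear structure of $\mathbb G$. A homogeneous subgroup is a Lie subgroup that is a linear subspace invariant under all $\delta_r$. A vertical subgroup is a homogeneous subgroup of the form $N_\ell\oplus H^{\ell+1}\oplus\cdots\oplus H^\iota$, with $\ell\in\{1,\dots,\iota\}$ and $N_\ell\subset H^\ell$ a linear subspace. $\mathcal H^n_{|\cdot|}$ is the $n$-dimensional Hausdorff measure of the Euclidean norm $|\cdot|$, normalized to agree with Lebesgue measure on $n$-dimensional affine subspaces. The spherical factor of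 an $n$-dimensional linear subspace $S\subset\mathbb G$ is $\beta_d(S)=\max_{d(u,0)\le1}\mathcal H^n_{|\cdot|}(\mathbb B(u,1)\cap S)$. *)

theory Defs
  imports "HOL-Analysis.Analysis"
begin

section \<open>The group law\<close>

text \<open>\<open>lie_word br [z1, ..., zm] = [z1, [z2, ... [z(m-1), zm] ...]]\<close>.\<close>

fun lie_word :: "('a::real_vector \<Rightarrow> 'a \<Rightarrow> 'a) \<Rightarrow> 'a list \<Rightarrow> 'a" where
  "lie_word br [] = 0"
| "lie_word br [z] = z"
| "lie_word br (z # w) = br z (lie_word br w)"

text \<open>Index set of Dynkin's form of the Baker-Campbell-Hausdorff series, truncated at words of
  length \<open>\<iota>\<close>. A list \<open>[(r1, s1), ..., (rk, sk)]\<close> stands for the word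
  \<open>x^r1 y^s1 ... x^rk y^sk\<close>.\<close>

definition bch_index :: "nat \<Rightarrow> (nat \<times> nat) list set" where
  "bch_index \<iota> = {p. p \<noteq> [] \<and> (\<forall>(r, s) \<in> set p. r + s > 0) \<and> (\<Sum>(r, s) \<leftarrow> p. r + s) \<le> \<iota>}"

definition bch_word :: "'a \<Rightarrow> 'a \<Rightarrow> (nat \<times> nat) list \<Rightarrow> 'a list" where
  "bch_word x y p = concat (map (\<lambda>(r, s). replicate r x @ replicate s y) p)"

definition bch_coeff :: "(nat \<times> nat) list \<Rightarrow> real" where
  "bch_coeff p = (- 1) ^ (length p - 1) /
     (real (length p) * real (\<Sum>(r, s) \<leftarrow> p. r + s) * (\<Prod>(r, s) \<leftarrow> p. fact r * fact s))"

text \<open>In a Lie algebra that is nilpotent of step at most \<open>\<iota>\<close>, the omitted terms of the series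
  vanish.\<close>

definition bch :: "nat \<Rightarrow> ('a::real_vector \<Rightarrow> 'a \<Rightarrow> 'a) \<Rightarrow> 'a \<Rightarrow> 'a \<Rightarrow> 'a" where
  "bch \<iota> br x y = (\<Sum>p \<in> bch_index \<iota>. bch_coeff p *\<^sub>R lie_word br (bch_word x y p))"

lemma finite_bch_index: "finite (bch_index \<iota>)"
proof (rule finite_subset)
  show "bch_index \<iota> \<subseteq> {p. set p \<subseteq> {..\<iota>} \<times> {..\<iota>} \<and> length p \<le> \<iota>}"
  proof
    fix p assume "p \<in> bch_index \<iota>"
    then have pos: "\<forall>(r, s) \<in> set p. r + s > 0" and le: "(\<Sum>(r, s) \<leftarrow> p. r + s) \<le> \<iota>"
      by (auto simp: bch_index_def)
    have "length p \<le> (\<Sum>(r, s) \<leftarrow> p. r + s)"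
      using pos by (induction p) auto
    moreover have "r + s \<le> (\<Sum>(r, s) \<leftarrow> p. r + s)" if "(r, s) \<in> set p" for r s
      using member_le_sum_list[of "r + s" "map (\<lambda>(r, s). r + s) p"] that by force
    ultimately show "p \<in> {p. set p \<subseteq> {..\<iota>} \<times> {..\<iota>} \<and> length p \<le> \<iota>}"
      using le by fastforce
  qed
  show "finite {p. set p \<subseteq> {..\<iota>} \<times> {..\<iota>} \<and> length p \<le> \<iota>}"
    by (rule finite_lists_length_le) simp
qed


section \<open>Homogeneous groups and homogeneous distances\<close>

definition dilation :: "(nat \<Rightarrow> 'a::real_vector set) \<Rightarrow> nat \<Rightarrow> real \<Rightarrow> 'a \<Rightarrow> 'a" where
  "dilation H \<iota> r = (THE D. linear D \<and> (\<forall>i \<in> {1..\<iota>}. \<forall>x \<in> H i. D x = r ^ i *\<^sub>R x))"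

text \<open>The fixed scalar product is the inner product of the type. Orthogonality makes the sum of the
  layers direct. The value \<open>H 0\<close> is not used. Nilpotency of the bracket follows from the grading,
  see \<open>nilpotent\<close> below.\<close>

locale homogeneous_group =
  fixes H :: "nat \<Rightarrow> 'a::euclidean_space set" and \<iota> :: nat and br :: "'a \<Rightarrow> 'a \<Rightarrow> 'a"
  assumes step_pos: "\<iota> \<ge> 1"
    and subspace_layer: "\<And>i. i \<in> {1..\<iota>} \<Longrightarrow> subspace (H i)"
    and layer_above: "\<And>i. i > \<iota> \<Longrightarrow> H i = {0}"
    and layer_top: "H \<iota> \<noteq> {0}"
    and span_layers: "span (\<Union>i\<in>{1..\<iota>}. H i) = UNIV"
    and orthogonal_layers:
      "\<And>i j x y. i \<in> {1..\<iota>} \<Longrightarrow> j \<in> {1..\<iota>} \<Longrightarrow> i \<noteq> j \<Longrightarrow> x \<in> H i \<Longrightarrow> y \<in> H j \<Longrightarrow> x \<bullet> y = 0"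
    and bilinear_bracket: "bilinear br"
    and bracket_self: "\<And>x. br x x = 0"
    and jacobi: "\<And>x y z. br x (br y z) + br y (br z x) + br z (br x y) = 0"
    and bracket_layers:
      "\<And>i j x y. i \<ge> 1 \<Longrightarrow> j \<ge> 1 \<Longrightarrow> x \<in> H i \<Longrightarrow> y \<in> H j \<Longrightarrow> br x y \<in> H (i + j)"
begin

lemma bracket_in_span:
  assumes "x \<in> span A" "y \<in> span B" and AB: "\<And>a b. a \<in> A \<Longrightarrow> b \<in> B \<Longrightarrow> br a b \<in> span C"
  shows "br x y \<in> span C"
proof -
  have lin: "linear (\<lambda>x. br x y)" "linear (br x)" for x y
    using bilinear_bracket by (auto simp: bilinear_def)
  have *: "br a y \<in> span C" if "a \<in> A" for a
    using \<open>y \<in> span B\<close>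
  proof (induction rule: span_induct)
    case base
    show ?case
      using linear_subspace_vimage[OF lin(2) subspace_span] by (simp add: vimage_def)
  qed (use AB that in auto)
  show ?thesis
    using \<open>x \<in> span A\<close>
  proof (induction rule: span_induct)
    case base
    show ?case
      using linear_subspace_vimage[OF lin(1) subspace_span] by (simp add: vimage_def)
  qed (use * in auto)
qed

lemma lie_word_in_tail:
  assumes "w \<noteq> []"
  shows "lie_word br w \<in> span (\<Union>i\<in>{length w..}. H i)"
  using assms
proof (induction w rule: list_nonempty_induct)
  case (single z)
  have "span (\<Union>i\<in>{1..\<iota>}. H i) \<subseteq> span (\<Union>i\<in>{1..}. H i)"
    by (intro span_mono) auto
  then show ?case using span_layers by auto
next
  case (cons z w)
  have "br z (lie_word br w) \<in> span (\<Union>i\<in>{length (z # w)..}. H i)"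
  proof (rule bracket_in_span[OF _ cons.IH])
    show "z \<in> span (\<Union>i\<in>{1..\<iota>}. H i)" using span_layers by simp
    fix a b assume "a \<in> (\<Union>i\<in>{1..\<iota>}. H i)" "b \<in> (\<Union>i\<in>{length w..}. H i)"
    then obtain i j where ij: "i \<ge> 1" "a \<in> H i" "j \<ge> length w" "b \<in> H j" by auto
    moreover have "length w \<ge> 1" using cons.hyps by (cases w) auto
    ultimately have "br a b \<in> H (i + j)" by (intro bracket_layers) auto
    then show "br a b \<in> span (\<Union>i\<in>{length (z # w)..}. H i)"
      using ij by (intro span_base UN_I[of "i + j"]) auto
  qed
  then show ?case using cons.hyps by (cases w) auto
qed

lemma nilpotent:
  assumes "length w > \<iota>"
  shows "lie_word br w = 0"
proof -
  have "(\<Union>i\<in>{length w..}. H i) \<subseteq> {0}"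
    using assms layer_above by auto
  then have "span (\<Union>i\<in>{length w..}. H i) \<subseteq> {0}"
    by (metis span_mono span_insert_0 span_empty)
  then show ?thesis
    using lie_word_in_tail[of w] assms by fastforce
qed

lemma dilation_unique:
  assumes "linear D" "\<And>i x. i \<in> {1..\<iota>} \<Longrightarrow> x \<in> H i \<Longrightarrow> D x = r ^ i *\<^sub>R x"
    and "linear E" "\<And>i x. i \<in> {1..\<iota>} \<Longrightarrow> x \<in> H i \<Longrightarrow> E x = r ^ i *\<^sub>R x"
  shows "D = E"
proof
  fix x
  show "D x = E x"
    by (rule linear_eq_on[OF assms(1,3), of _ "\<Union>i\<in>{1..\<iota>}. H i"])
       (use assms span_layers in auto)
qed

lemma dilation_exists:
  "\<exists>D. linear D \<and> (\<forall>i \<in> {1..\<iota>}. \<forall>x \<in> H i. D x = r ^ i *\<^sub>R x)"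
proof -
  have "\<exists>B. B \<subseteq> H i \<and> pairwise orthogonal B \<and> (\<forall>b\<in>B. norm b = 1) \<and> finite B \<and> span B = H i"
    if i: "i \<in> {1..\<iota>}" for i
  proof -
    obtain B where B: "B \<subseteq> H i" "pairwise orthogonal B" "\<And>x. x \<in> B \<Longrightarrow> norm x = 1"
      "independent B" "card B = dim (H i)" "span B = H i"
      using orthonormal_basis_subspace[OF subspace_layer[OF i]] by metis
    then show ?thesis using independent_imp_finite by blast
  qed
  then obtain B where B: "\<And>i. i \<in> {1..\<iota>} \<Longrightarrow> B i \<subseteq> H i \<and> pairwise orthogonal (B i) \<and>
      (\<forall>b\<in>B i. norm b = 1) \<and> finite (B i) \<and> span (B i) = H i"
    by metis
  define P where "P i x = (\<Sum>b\<in>B i. (x \<bullet> b) *\<^sub>R b)" for i x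
  define D where "D x = (\<Sum>i\<in>{1..\<iota>}. r ^ i *\<^sub>R P i x)" for x
  have linP: "linear (P i)" for i
    unfolding P_def by (intro linear_compose_sum) (auto intro!: linearI simp: algebra_simps)
  have "linear D"
    unfolding D_def
    by (intro linear_compose_sum)
       (auto intro!: linearI simp: linear_add[OF linP] linear_scale[OF linP] algebra_simps)
  moreover have "D x = r ^ i *\<^sub>R x" if i: "i \<in> {1..\<iota>}" and x: "x \<in> H i" for i x
  proof -
    have "P i x = x"
    proof -
      have "P i b = b" if "b \<in> B i" for b
      proof -
        have "P i b = (\<Sum>c\<in>B i. if c = b then b else 0)"
          unfolding P_def using B[OF i] that
          by (intro sum.cong) (auto simp: pairwise_def orthogonal_def norm_eq_1)
        then show ?thesis using B[OF i] that by simp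
      qed
      then show ?thesis
        using linear_eq_on[OF linP linear_id, of x "B i" i] B[OF i] x by auto
    qed
    moreover have "P j x = 0" if "j \<in> {1..\<iota>}" "j \<noteq> i" for j
      unfolding P_def using orthogonal_layers[OF i that(1)] that x B[OF that(1)]
      by (intro sum.neutral) (auto simp: subset_iff)
    ultimately have "D x = (\<Sum>j\<in>{1..\<iota>}. if j = i then r ^ i *\<^sub>R x else 0)"
      unfolding D_def by (intro sum.cong) auto
    then show ?thesis using i by simp
  qed
  ultimately show ?thesis by blast
qed

lemma dilation_properties:
  "linear (dilation H \<iota> r) \<and> (\<forall>i \<in> {1..\<iota>}. \<forall>x \<in> H i. dilation H \<iota> r x = r ^ i *\<^sub>R x)"
proof -
  have "\<exists>!D. linear D \<and> (\<forall>i \<in> {1..\<iota>}. \<forall>x \<in> H i. D x = r ^ i *\<^sub>R x)"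
    using dilation_exists[of r] dilation_unique[where r = r] by (metis (no_types, lifting))
  then show ?thesis unfolding dilation_def by (rule theI')
qed

end

locale homogeneous_distance =
  homogeneous_group H \<iota> br + Metric_space "UNIV :: 'a set" d
  for H :: "nat \<Rightarrow> 'a::euclidean_space set" and \<iota> br and d :: "'a \<Rightarrow> 'a \<Rightarrow> real" +
  assumes left_invariant: "\<And>u x y. d (bch \<iota> br u x) (bch \<iota> br u y) = d x y"
    and dilation_homogeneous:
      "\<And>r x y. r > 0 \<Longrightarrow> d (dilation H \<iota> r x) (dilation H \<iota> r y) = r * d x y"

abbreviation closed_ball :: "('a \<Rightarrow> 'a \<Rightarrow> real) \<Rightarrow> 'a \<Rightarrow> real \<Rightarrow> 'a set" where
  "closed_ball d \<equiv> Metric_space.mcball UNIV d"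


section \<open>Vertical subgroups\<close>

text \<open>The identity of the group is \<open>0\<close> and the inverse of \<open>x\<close> is \<open>- x\<close>, so every linear subspace
  contains the identity and is closed under inversion; a linear subspace is also a closed
  submanifold, so it is a Lie subgroup as soon as it is closed under the product.\<close>

definition homogeneous_subgroup ::
    "(nat \<Rightarrow> 'a::euclidean_space set) \<Rightarrow> nat \<Rightarrow> ('a \<Rightarrow> 'a \<Rightarrow> 'a) \<Rightarrow> 'a set \<Rightarrow> bool" where
  "homogeneous_subgroup H \<iota> br S \<longleftrightarrow>
     subspace S \<and> (\<forall>x\<in>S. \<forall>y\<in>S. bch \<iota> br x y \<in> S) \<and> (\<forall>r>0. \<forall>x\<in>S. dilation H \<iota> r x \<in> S)"

definition vertical_subgroup ::
    "(nat \<Rightarrow> 'a::euclidean_space set) \<Rightarrow> nat \<Rightarrow> ('a \<Rightarrow> 'a \<Rightarrow> 'a) \<Rightarrow> 'a set \<Rightarrow> bool" where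
  "vertical_subgroup H \<iota> br N \<longleftrightarrow>
     homogeneous_subgroup H \<iota> br N \<and>
     (\<exists>l \<in> {1..\<iota>}. \<exists>N\<^sub>l. subspace N\<^sub>l \<and> N\<^sub>l \<subseteq> H l \<and> N = span (N\<^sub>l \<union> (\<Union>j\<in>{l + 1..\<iota>}. H j)))"


section \<open>Hausdorff measure and spherical factor\<close>

text \<open>The factor \<open>unit_ball_vol n / 2 ^ n\<close> is the one for which the measure agrees with Lebesgue
  measure on \<open>n\<close>-dimensional affine subspaces, by the isodiametric inequality. The empty set gets
  weight \<open>0\<close> explicitly because \<open>0 ^ 0 = 1\<close>. Boundedness is required because \<open>diameter\<close> has no
  meaningful value on unbounded sets.\<close>

definition hausdorff_weight :: "nat \<Rightarrow> 'a::metric_space set \<Rightarrow> ennreal" where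
  "hausdorff_weight n C =
     (if C = {} then 0 else ennreal (unit_ball_vol (real n) * (diameter C / 2) ^ n))"

definition hausdorff_content :: "nat \<Rightarrow> real \<Rightarrow> 'a::metric_space set \<Rightarrow> ennreal" where
  "hausdorff_content n \<delta> E =
     (INF C \<in> {C :: nat \<Rightarrow> 'a set. E \<subseteq> (\<Union>i. C i) \<and> (\<forall>i. bounded (C i) \<and> diameter (C i) \<le> \<delta>)}.
        \<Sum>i. hausdorff_weight n (C i))"

definition hausdorff_measure :: "nat \<Rightarrow> 'a::metric_space set \<Rightarrow> ennreal" where
  "hausdorff_measure n E = (SUP \<delta> \<in> {0<..}. hausdorff_content n \<delta> E)"

text \<open>\<open>GREATEST\<close> is the maximum, not merely a supremum: it is specified only if the maximum is
  attained.\<close>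

definition spherical_factor :: "('a::euclidean_space \<Rightarrow> 'a \<Rightarrow> real) \<Rightarrow> 'a set \<Rightarrow> ennreal" where
  "spherical_factor d S =
     (GREATEST m. \<exists>u. d u 0 \<le> 1 \<and> m = hausdorff_measure (dim S) (closed_ball d u 1 \<inter> S))"

end

theory Submission
  imports Defs
begin

text \<open>Let \<open>B\<close> be the unit ball around \<open>0\<close> and \<open>u\<close> the centre of another unit ball. The map
  \<open>x \<mapsto> bch u (x - u)\<close> sends \<open>N\<close> to itself, because brackets with elements of \<open>N\<close> lie in the
  layers above the lowest layer of \<open>N\<close>; in coordinates adapted to the layers it is unipotent and
  triangular, so it preserves Lebesgue measure on \<open>N\<close>. By left invariance the preimage of the ball
  around \<open>u\<close> is the linear translate \<open>u + B\<close>. As \<open>B\<close> is convex and symmetric, the sections of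
  \<open>u + B\<close> and \<open>- u + B\<close> by \<open>N\<close> are reflections of each other whose midpoints lie in \<open>B\<close>, and the
  Brunn--Minkowski inequality shows that neither is larger than the section of \<open>B\<close>. Hausdorff
  measure on \<open>N\<close> is a multiple of Lebesgue measure, by uniqueness of Haar measure.\<close>

text \<open>Group translations are polynomial and in general not affine, so convexity of
  \<open>B\<close> says nothing directly about the ball around \<open>u\<close>; this is why that
  ball is first traded for a linear translate. What is then compared is the section of
  \<open>B\<close> by a parallel translate of \<open>N\<close> with the section by \<open>N\<close>
  itself, the classical setting in which the central section of a symmetric convex body is the
  largest. Writing \<open>|A|\<close> for the Lebesgue measure of the section of
  \<open>A = u + B\<close>, Brunn--Minkowski is used in the multiplicative form
  \<open>|A| * |-A| <= |B|^2\<close>. Its functional version, the Prekopa--Leindler inequality,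
  passes through Fubini one coordinate at a time, and with \<open>|-A| = |A|\<close> it yields
  \<open>|A| <= |B|\<close> without an exponent depending on the dimension. A homogeneous distance
  is given only as a metric with two compatibility laws, with no reference to the Euclidean
  topology; that \<open>B\<close> is a bounded neighbourhood of \<open>0\<close> and that
  \<open>d 0\<close> is continuous is derived from convexity, symmetry and dilations.\<close>

section \<open>Hausdorff measure\<close>

text \<open>Caratheodory's criterion for metric outer measures. The parts \<open>Y k\<close> of
  \<open>X - C\<close> keep a positive distance from \<open>C\<close>, so \<open>sep\<close> gives
  additivity there. What remains is cut into shells \<open>R j\<close> by the distance to
  \<open>C\<close>. Shells of equal parity are separated, so the series of their measures converges,
  and its tails, which bound the error, vanish.\<close>

lemma metric_outer_measure_closed:
  fixes f :: "'a::metric_space set \<Rightarrow> ennreal"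
  assumes outer: "outer_measure_space (Pow UNIV) f"
    and sep: "\<And>A B e. e > 0 \<Longrightarrow> (\<And>x y. x \<in> A \<Longrightarrow> y \<in> B \<Longrightarrow> e \<le> dist x y) \<Longrightarrow>
      f A + f B \<le> f (A \<union> B)"
    and C: "closed C"
  shows "C \<in> lambda_system UNIV (Pow UNIV) f"
proof -
  have f0: "f {} = 0"
    using outer by (auto simp: outer_measure_space_def positive_def)
  have mono: "f A \<le> f B" if "A \<subseteq> B" for A B
    using outer that by (auto simp: outer_measure_space_def increasing_def)
  have csub: "f (\<Union>i. A i) \<le> (\<Sum>i. f (A i))" if "disjoint_family A" for A :: "nat \<Rightarrow> 'a set"
    using outer that by (auto simp: outer_measure_space_def countably_subadditive_def)
  have sub: "f (A \<union> B) \<le> f A + f B" if "A \<inter> B = {}" for A B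
    using outer ring_of_sets.countably_subadditive_subadditive[OF ring_of_sets_Pow, of UNIV f] that
    by (auto simp: outer_measure_space_def subadditive_def)
  have main: "f (X \<inter> C) + f (X - C) \<le> f X" if ne: "C \<noteq> {}" and fin: "f X < \<infinity>" for X
  proof -
    define g where "g x = infdist x C" for x
    have g: "g x - g y \<le> dist x y" for x y
      unfolding g_def using infdist_triangle[of x C y] by simp
    define R where "R j = {x\<in>X. 1 / (real j + 2) \<le> g x \<and> g x < 1 / (real j + 1)}" for j
    define Y where "Y k = {x\<in>X. 1 / (real k + 1) \<le> g x}" for k
    \<comment> \<open>Between two different shells of equal parity lies at least one whole shell, so
      the values of \<open>g\<close> on them differ by at least its width; \<open>g\<close> is
      1-Lipschitz, hence the points are that far apart.\<close>
    have parity: "(\<Sum>j<n. f (R (2 * j + p))) \<le> f (\<Union>j<n. R (2 * j + p))" for n p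
    proof (induction n)
      case (Suc n)
      have step: "f (\<Union>j<n. R (2 * j + p)) + f (R (2 * n + p))
        \<le> f ((\<Union>j<n. R (2 * j + p)) \<union> R (2 * n + p))"
      proof (cases "n = 0")
        case False
        \<comment> \<open>The width of the shell of index \<open>2 * n + p - 1\<close>. For
          \<open>n = 0\<close> there is no such separation to prove, as the union is empty.\<close>
        let ?e = "1 / real (2 * n + p) - 1 / real (2 * n + p + 1)"
        show ?thesis
        proof (rule sep)
          have "1 / real (2 * n + p + 1) < 1 / real (2 * n + p)"
            using False by (intro divide_strict_left_mono) auto
          then show "?e > 0" by simp
          fix x y assume "x \<in> (\<Union>j<n. R (2 * j + p))" and y: "y \<in> R (2 * n + p)"
          then obtain j where j: "j < n" "x \<in> R (2 * j + p)" by auto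
          have "1 / real (2 * n + p) \<le> 1 / (real (2 * j + p) + 2)"
            using j by (intro divide_left_mono) auto
          also have "\<dots> \<le> g x" using j by (simp add: R_def)
          finally have "1 / real (2 * n + p) \<le> g x" .
          moreover have "g y < 1 / real (2 * n + p + 1)" using y by (simp add: R_def add_ac)
          ultimately show "?e \<le> dist x y" using g[of x y] by linarith
        qed
      qed (simp add: f0)
      have "(\<Sum>j<Suc n. f (R (2 * j + p))) \<le> f (\<Union>j<n. R (2 * j + p)) + f (R (2 * n + p))"
        using Suc by (simp add: add_right_mono)
      also note step
      also have "(\<Union>j<n. R (2 * j + p)) \<union> R (2 * n + p) = (\<Union>j<Suc n. R (2 * j + p))"
        by (auto simp: lessThan_Suc)
      finally show ?case .
    qed (simp add: f0)
    have parity': "(\<Sum>j<n. f (R (2 * j + p))) \<le> f X" for n p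
      by (rule order_trans[OF parity mono]) (auto simp: R_def)
    have "(\<Sum>j<n. f (R j)) \<le> f X + f X" for n
    proof -
      have "(\<Sum>j<n. f (R j)) \<le> (\<Sum>j<2 * n. f (R j))"
        by (rule sum_mono2) auto
      also have "\<dots> = (\<Sum>j<n. f (R (2 * j + 0))) + (\<Sum>j<n. f (R (2 * j + 1)))"
        by (induction n) (simp_all add: add_ac)
      also have "\<dots> \<le> f X + f X"
        by (intro add_mono parity')
      finally show ?thesis .
    qed
    then have "(\<Sum>j. f (R j)) \<le> f X + f X"
      by (intro suminf_le_const) auto
    then have tot: "(\<Sum>j. f (R j)) < \<infinity>"
      using fin by (metis ennreal_add_less_top infinity_ennreal_def order_le_less_trans)
    have fR: "f (R j) < \<infinity>" for j
      using mono[of "R j" X] fin by (auto simp: R_def intro: le_less_trans)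
    define r where "r j = enn2real (f (R j))" for j
    have r: "f (R j) = ennreal (r j)" "r j \<ge> 0" for j
      using fR[of j] by (auto simp: r_def)
    have "summable r"
      using tot r by (intro summable_suminf_not_top) auto
    then have "(\<lambda>k. \<Sum>j. r (j + k)) \<longlonglongrightarrow> 0"
      by (rule suminf_exist_split2)
    then have lim: "(\<lambda>k. ennreal (\<Sum>j. r (j + k))) \<longlonglongrightarrow> ennreal 0"
      by (rule tendsto_ennrealI)
    have tail: "(\<Sum>j. f (R (j + k))) = ennreal (\<Sum>j. r (j + k))" for k
      using \<open>summable r\<close> r by (simp add: suminf_ennreal2 summable_iff_shift)
    have bound: "f (X \<inter> C) + f (X - C) \<le> f X + ennreal (\<Sum>j. r (j + k))" for k
    proof -
      have pos: "g x > 0" if "x \<notin> C" for x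
        unfolding g_def using infdist_pos_not_in_closed[OF C ne that] .
      have disj: "disjoint_family (\<lambda>j. R (j + k))"
        unfolding disjoint_family_on_def
      proof (intro ballI impI)
        fix m n :: nat assume mn: "m \<noteq> n"
        have *: False if "i < j" "x \<in> R (i + k)" "x \<in> R (j + k)" for i j x
        proof -
          have "1 / (real (j + k) + 1) \<le> 1 / (real (i + k) + 2)"
            using that(1) by (intro divide_left_mono) auto
          then show False using that by (auto simp: R_def)
        qed
        show "R (m + k) \<inter> R (n + k) = {}"
          using mn *[of m n] *[of n m] by (auto simp: neq_iff)
      qed
      have cover: "X - C \<subseteq> Y k \<union> (\<Union>j. R (j + k))"
      proof
        fix x assume x: "x \<in> X - C"
        define P where "P j \<longleftrightarrow> 1 / (real j + 1) \<le> g x" for j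
        obtain n where "inverse (real (Suc n)) < g x"
          using reals_Archimedean[OF pos[of x]] x by auto
        then have n: "P n" by (simp add: P_def inverse_eq_divide add.commute)
        \<comment> \<open>The first index with \<open>1 / (m + 1) \<le> g x\<close>. If
          \<open>m \<le> k\<close>, the point is in \<open>Y k\<close>; otherwise minimality puts it
          into the shell of index \<open>m - 1\<close>.\<close>
        define m where "m = (LEAST j. P j)"
        have m: "P m" unfolding m_def by (rule LeastI, rule n)
        have anti: "1 / (real j + 1) \<le> 1 / (real i + 1)" if "i \<le> j" for i j
          using that by (intro divide_left_mono) auto
        show "x \<in> Y k \<union> (\<Union>j. R (j + k))"
        proof (cases "m \<le> k")
          case True
          from m have "1 / (real m + 1) \<le> g x" by (simp add: P_def)
          with anti[OF True] have "1 / (real k + 1) \<le> g x" by linarith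
          then show ?thesis using x by (simp add: Y_def)
        next
          case False
          then obtain i where i: "m = Suc (i + k)"
            by (metis add.commute less_imp_Suc_add not_le)
          have "\<not> P (i + k)" using not_less_Least[of "i + k" P] i m_def by auto
          then have "x \<in> R (i + k)" using m x by (simp add: P_def R_def i add_ac not_le)
          then show ?thesis by auto
        qed
      qed
      have YR: "Y k \<inter> (\<Union>j. R (j + k)) = {}"
      proof -
        have "1 / (real (j + k) + 1) \<le> 1 / (real k + 1)" for j
          by (intro divide_left_mono) auto
        then have "\<not> (1 / (real k + 1) \<le> z \<and> z < 1 / (real (j + k) + 1))" for z j
          by (meson not_less order_trans)
        then show ?thesis by (auto simp: Y_def R_def)
      qed
      have "f (X - C) \<le> f (Y k) + f (\<Union>j. R (j + k))"
        by (rule order_trans[OF mono[OF cover] sub[OF YR]])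
      also have "\<dots> \<le> f (Y k) + ennreal (\<Sum>j. r (j + k))"
        using csub[OF disj] tail by (auto intro: add_left_mono)
      finally have 1: "f (X - C) \<le> f (Y k) + ennreal (\<Sum>j. r (j + k))" .
      have "f (X \<inter> C) + f (Y k) \<le> f (X \<inter> C \<union> Y k)"
      proof (rule sep)
        show "1 / (real k + 1) > 0" by simp
        fix x y assume "x \<in> X \<inter> C" "y \<in> Y k"
        then have "g x = 0" "1 / (real k + 1) \<le> g y" by (auto simp: g_def Y_def)
        then show "1 / (real k + 1) \<le> dist x y" using g[of y x] by (simp add: dist_commute)
      qed
      also have "\<dots> \<le> f X" by (rule mono) (auto simp: Y_def)
      finally have 2: "f (X \<inter> C) + f (Y k) \<le> f X" .
      have "f (X \<inter> C) + f (X - C) \<le> f (X \<inter> C) + (f (Y k) + ennreal (\<Sum>j. r (j + k)))"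
        using 1 by (rule add_left_mono)
      also have "\<dots> \<le> f X + ennreal (\<Sum>j. r (j + k))"
        using 2 by (simp add: add.assoc[symmetric] add_right_mono)
      finally show ?thesis .
    qed
    have "(\<lambda>k. f X + ennreal (\<Sum>j. r (j + k))) \<longlonglongrightarrow> f X + ennreal 0"
      by (intro tendsto_add lim tendsto_const)
    then show ?thesis
      by (intro LIMSEQ_le_const[where x = "f X"]) (use bound in auto)
  qed
  have "f (X \<inter> C) + f (X - C) = f X" for X
  proof (rule antisym)
    show "f (X \<inter> C) + f (X - C) \<le> f X"
    proof (cases "C \<noteq> {} \<and> f X < \<infinity>")
      case True
      then show ?thesis using main[of X] by auto
    next
      case False
      then show ?thesis using f0 by (cases "C = {}") (auto simp: top.not_eq_extremum[symmetric])
    qed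
    show "f X \<le> f (X \<inter> C) + f (X - C)"
      using sub[of "X \<inter> C" "X - C"] by (simp add: Int_Diff_disjoint Int_Diff_Un)
  qed
  moreover have "algebra UNIV (Pow (UNIV :: 'a set))"
    by (rule algebra_Pow)
  ultimately show ?thesis
    by (simp add: algebra.lambda_system_eq)
qed

section \<open>Hausdorff measure as a Borel measure\<close>

lemma hausdorff_weight_empty [simp]: "hausdorff_weight n {} = 0"
  by (simp add: hausdorff_weight_def)

lemma hausdorff_content_empty [simp]: "\<delta> > 0 \<Longrightarrow> hausdorff_content n \<delta> {} = 0"
  unfolding hausdorff_content_def
  by (rule antisym, rule INF_lower2[of "\<lambda>_. {}"]) auto

lemma hausdorff_content_mono:
  "A \<subseteq> B \<Longrightarrow> hausdorff_content n \<delta> A \<le> hausdorff_content n \<delta> B"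
  unfolding hausdorff_content_def by (rule INF_superset_mono) auto

lemma hausdorff_content_antimono:
  assumes "\<epsilon> \<le> \<delta>"
  shows "hausdorff_content n \<delta> A \<le> hausdorff_content n \<epsilon> A"
proof -
  have "diameter C \<le> \<delta>" if "diameter C \<le> \<epsilon>" for C :: "'a set"
    using that assms by linarith
  then show ?thesis
    unfolding hausdorff_content_def by (intro INF_superset_mono) auto
qed

lemma hausdorff_content_UN:
  fixes A :: "nat \<Rightarrow> 'a::metric_space set"
  shows "hausdorff_content n \<delta> (\<Union>i. A i) \<le> (\<Sum>i. hausdorff_content n \<delta> (A i))"
proof (cases "\<forall>i. hausdorff_content n \<delta> (A i) < \<infinity>")
  case False
  then have "(\<Sum>i. hausdorff_content n \<delta> (A i)) = \<infinity>"
    by (metis (no_types, lifting) ennreal_suminf_lessD infinity_ennreal_def top.not_eq_extremum)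
  then show ?thesis by simp
next
  case True
  show ?thesis
  proof (rule ennreal_le_epsilon)
    fix e :: real assume "e > 0"
    let ?cov = "\<lambda>E. {C :: nat \<Rightarrow> 'a set. E \<subseteq> (\<Union>i. C i) \<and> (\<forall>i. bounded (C i) \<and> diameter (C i) \<le> \<delta>)}"
    have "\<exists>C\<in>?cov (A i). (\<Sum>j. hausdorff_weight n (C j))
        < hausdorff_content n \<delta> (A i) + ennreal (e * (1 / 2) ^ Suc i)" for i
      using True[rule_format, of i] \<open>e > 0\<close>
      by (intro INF_approx_ennreal[OF _ hausdorff_content_def]) auto
    then have "\<forall>i. \<exists>C. C \<in> ?cov (A i) \<and> (\<Sum>j. hausdorff_weight n (C j))
        < hausdorff_content n \<delta> (A i) + ennreal (e * (1 / 2) ^ Suc i)"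
      by blast
    from choice[OF this] obtain C where "\<forall>i. C i \<in> ?cov (A i) \<and>
        (\<Sum>j. hausdorff_weight n (C i j)) < hausdorff_content n \<delta> (A i) + ennreal (e * (1 / 2) ^ Suc i)"
      by (rule exE)
    note C = this[THEN spec, THEN conjunct1] this[THEN spec, THEN conjunct2]
    define D where "D k = (case prod_decode k of (i, j) \<Rightarrow> C i j)" for k
    have D: "D (prod_encode (i, j)) = C i j" for i j by (simp add: D_def)
    have "D \<in> ?cov (\<Union>i. A i)"
    proof -
      have "x \<in> (\<Union>k. D k)" if "x \<in> A i" for x i
      proof -
        have "A i \<subseteq> (\<Union>j. C i j)" using C(1)[of i] by simp
        with that obtain j where "x \<in> C i j" by auto
        then have "x \<in> D (prod_encode (i, j))" by (simp add: D)
        then show ?thesis by blast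
      qed
      moreover have "bounded (D k) \<and> diameter (D k) \<le> \<delta>" for k
        using C(1) by (auto simp: D_def split: prod.split)
      ultimately show ?thesis by auto
    qed
    then have "hausdorff_content n \<delta> (\<Union>i. A i) \<le> (\<Sum>k. hausdorff_weight n (D k))"
      unfolding hausdorff_content_def by (rule INF_lower)
    also have "\<dots> = (\<Sum>k. (\<lambda>(i, j). hausdorff_weight n (C i j)) (prod_decode k))"
      by (simp add: D_def case_prod_unfold)
    also have "\<dots> = (\<Sum>i. \<Sum>j. hausdorff_weight n (C i j))"
      by (rule suminf_ennreal_2dimen) simp
    also have "\<dots> \<le> (\<Sum>i. hausdorff_content n \<delta> (A i) + ennreal (e * (1 / 2) ^ Suc i))"
      by (intro suminf_le less_imp_le C(2)) auto
    also have "\<dots> = (\<Sum>i. hausdorff_content n \<delta> (A i)) + (\<Sum>i. ennreal (e * (1 / 2) ^ Suc i))"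
      by (rule suminf_add[symmetric]) auto
    also have "(\<Sum>i. ennreal (e * (1 / 2) ^ Suc i)) = ennreal e"
      using \<open>e > 0\<close> sums_mult[OF power_half_series, of e]
      by (intro suminf_ennreal_eq) auto
    finally show "hausdorff_content n \<delta> (\<Union>i. A i) \<le> (\<Sum>i. hausdorff_content n \<delta> (A i)) + ennreal e" .
  qed
qed

text \<open>A covering set of diameter at most \<open>\<delta> < e\<close> cannot meet both
  \<open>A\<close> and \<open>B\<close>, so a cover of the union splits into a cover of
  \<open>A\<close> and a cover of \<open>B\<close> that share no set.\<close>

lemma hausdorff_content_separated:
  assumes "\<delta> < e" and sep: "\<And>x y. x \<in> A \<Longrightarrow> y \<in> B \<Longrightarrow> e \<le> dist x y"
  shows "hausdorff_content n \<delta> A + hausdorff_content n \<delta> B \<le> hausdorff_content n \<delta> (A \<union> B)"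
  unfolding hausdorff_content_def[of n \<delta> "A \<union> B"]
proof (rule INF_greatest)
  fix C :: "nat \<Rightarrow> 'a set"
  assume "C \<in> {C. A \<union> B \<subseteq> (\<Union>i. C i) \<and> (\<forall>i. bounded (C i) \<and> diameter (C i) \<le> \<delta>)}"
  then have C: "A \<union> B \<subseteq> (\<Union>i. C i)" "\<And>i. bounded (C i)" "\<And>i. diameter (C i) \<le> \<delta>" by auto
  \<comment> \<open>Covering sets that miss \<open>X\<close> become empty instead of being dropped,
    which keeps the indexing by \<open>nat\<close>. They cost nothing even for \<open>n = 0\<close>,
    because the empty set has weight \<open>0\<close>.\<close>
  define P where "P X i = (if C i \<inter> X = {} then {} else C i)" for X i
  have "hausdorff_content n \<delta> X \<le> (\<Sum>i. hausdorff_weight n (P X i))" if "X \<subseteq> (\<Union>i. C i)" for X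
  proof (cases "X = {}")
    case True
    then show ?thesis unfolding hausdorff_content_def
      using C(2,3) diameter_ge_0[OF C(2)] order_trans[OF diameter_ge_0[OF C(2)] C(3)]
      by (intro INF_lower) (auto simp: P_def)
  next
    case False
    show ?thesis unfolding hausdorff_content_def
      using C(2,3) that order_trans[OF diameter_ge_0[OF C(2)] C(3)]
      by (intro INF_lower) (fastforce simp: P_def)
  qed
  then have "hausdorff_content n \<delta> A + hausdorff_content n \<delta> B
      \<le> (\<Sum>i. hausdorff_weight n (P A i)) + (\<Sum>i. hausdorff_weight n (P B i))"
    using C(1) by (intro add_mono) auto
  also have "\<dots> = (\<Sum>i. hausdorff_weight n (P A i) + hausdorff_weight n (P B i))"
    by (rule suminf_add) auto
  also have "\<dots> \<le> (\<Sum>i. hausdorff_weight n (C i))"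
  proof (rule suminf_le)
    fix i
    have "C i \<inter> A = {} \<or> C i \<inter> B = {}"
    proof (rule ccontr)
      assume "\<not> ?thesis"
      then obtain x y where "x \<in> C i" "x \<in> A" "y \<in> C i" "y \<in> B" by blast
      then have "e \<le> dist x y" "dist x y \<le> diameter (C i)"
        using sep diameter_bounded_bound[OF C(2)] by auto
      then show False using C(3)[of i] \<open>\<delta> < e\<close> by linarith
    qed
    then show "hausdorff_weight n (P A i) + hausdorff_weight n (P B i) \<le> hausdorff_weight n (C i)"
      by (auto simp: P_def)
  qed auto
  finally show "hausdorff_content n \<delta> A + hausdorff_content n \<delta> B \<le> (\<Sum>i. hausdorff_weight n (C i))" .
qed

lemma hausdorff_measure_separated:
  assumes "e > 0" and sep: "\<And>x y. x \<in> A \<Longrightarrow> y \<in> B \<Longrightarrow> e \<le> dist x y"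
  shows "hausdorff_measure n A + hausdorff_measure n B \<le> hausdorff_measure n (A \<union> B)"
proof -
  have "hausdorff_content n \<delta> A + hausdorff_content n \<epsilon> B \<le> hausdorff_measure n (A \<union> B)"
    if "\<delta> > 0" "\<epsilon> > 0" for \<delta> \<epsilon>
  proof -
    \<comment> \<open>The suprema that define the two measures run over independent scales. Contents
      grow as the scale shrinks, so both can be moved to a common smaller one; \<open>e / 2\<close>
      keeps it strictly below the separation.\<close>
    define \<zeta> where "\<zeta> = min (min \<delta> \<epsilon>) (e / 2)"
    have z: "\<zeta> > 0" "\<zeta> \<le> \<delta>" "\<zeta> \<le> \<epsilon>" "\<zeta> < e" using that \<open>e > 0\<close> by (auto simp: \<zeta>_def)
    have "hausdorff_content n \<delta> A + hausdorff_content n \<epsilon> B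
        \<le> hausdorff_content n \<zeta> A + hausdorff_content n \<zeta> B"
      using z by (intro add_mono hausdorff_content_antimono)
    also have "\<dots> \<le> hausdorff_content n \<zeta> (A \<union> B)"
      using z(4) sep by (rule hausdorff_content_separated)
    also have "\<dots> \<le> hausdorff_measure n (A \<union> B)"
      unfolding hausdorff_measure_def using z by (intro SUP_upper) auto
    finally show ?thesis .
  qed
  note bound = this
  have ne: "{0::real<..} \<noteq> {}"
    using gt_ex[of "0::real"] by auto
  have "hausdorff_measure n A + hausdorff_content n \<epsilon> B \<le> hausdorff_measure n (A \<union> B)"
    if "\<epsilon> > 0" for \<epsilon>
    unfolding hausdorff_measure_def[of n A] ennreal_SUP_add_left[OF ne, symmetric]
    by (rule SUP_least) (use bound that in auto)
  then show ?thesis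
    unfolding hausdorff_measure_def[of n B] ennreal_SUP_add_right[OF ne]
    by (intro SUP_least) auto
qed

lemma hausdorff_measure_mono:
  "A \<subseteq> B \<Longrightarrow> hausdorff_measure n A \<le> hausdorff_measure n B"
  unfolding hausdorff_measure_def by (intro SUP_mono) (auto intro: hausdorff_content_mono)

lemma hausdorff_measure_empty [simp]: "hausdorff_measure n {} = 0"
  unfolding hausdorff_measure_def by (rule antisym[OF SUP_least]) auto

lemma hausdorff_measure_outer:
  "outer_measure_space (Pow UNIV) (hausdorff_measure n :: 'a::metric_space set \<Rightarrow> ennreal)"
  unfolding outer_measure_space_def
proof (intro conjI)
  show "positive (Pow UNIV) (hausdorff_measure n :: 'a set \<Rightarrow> ennreal)"
    by (simp add: positive_def)
  show "increasing (Pow UNIV) (hausdorff_measure n :: 'a set \<Rightarrow> ennreal)"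
    by (simp add: increasing_def hausdorff_measure_mono)
  show "countably_subadditive (Pow UNIV) (hausdorff_measure n :: 'a set \<Rightarrow> ennreal)"
    unfolding countably_subadditive_def
  proof (intro allI impI)
    fix A :: "nat \<Rightarrow> 'a set"
    show "hausdorff_measure n (\<Union>i. A i) \<le> (\<Sum>i. hausdorff_measure n (A i))"
      unfolding hausdorff_measure_def[of n "\<Union>i. A i"]
    proof (rule SUP_least)
      fix \<delta> :: real assume "\<delta> \<in> {0<..}"
      then show "hausdorff_content n \<delta> (\<Union>i. A i) \<le> (\<Sum>i. hausdorff_measure n (A i))"
        by (intro order_trans[OF hausdorff_content_UN] suminf_le)
           (auto simp: hausdorff_measure_def intro: SUP_upper)
    qed
  qed
qed

text \<open>\<open>measure_of\<close> falls back to the null measure when its argument is not a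
  measure on the generated sigma-algebra, so the definition has its intended content only through
  \<open>emeasure_hausdorff_borel\<close>.\<close>

definition hausdorff_borel :: "nat \<Rightarrow> 'a::metric_space measure" where
  "hausdorff_borel n = measure_of UNIV (sets borel) (hausdorff_measure n)"

lemma sets_hausdorff_borel [simp, measurable_cong]: "sets (hausdorff_borel n) = sets borel"
  and space_hausdorff_borel [simp]: "space (hausdorff_borel n) = UNIV"
  using sets.sigma_sets_eq[of borel] by (simp_all add: hausdorff_borel_def space_measure_of_conv)

text \<open>The Caratheodory measurable sets form a sigma-algebra on which the outer measure is
  countably additive. By the metric criterion it contains the closed sets, hence all Borel
  sets.\<close>

lemma emeasure_hausdorff_borel:
  assumes A: "A \<in> sets (borel :: 'a::metric_space measure)"
  shows "emeasure (hausdorff_borel n) A = hausdorff_measure n A"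
proof -
  let ?L = "lambda_system UNIV (Pow UNIV) (hausdorff_measure n :: 'a set \<Rightarrow> ennreal)"
  interpret P: sigma_algebra UNIV "Pow (UNIV :: 'a set)" by (rule sigma_algebra_Pow)
  have L: "measure_space UNIV ?L (hausdorff_measure n)"
    by (rule P.caratheodory_lemma[OF hausdorff_measure_outer])
  then have sL: "sigma_algebra UNIV ?L" by (simp add: measure_space_def)
  have "C \<in> ?L" if "closed C" for C
    by (rule metric_outer_measure_closed[OF hausdorff_measure_outer _ that])
       (rule hausdorff_measure_separated)
  then have "Collect closed \<subseteq> ?L" by auto
  then have "sigma_sets UNIV (Collect closed) \<subseteq> ?L"
    by (rule sigma_algebra.sigma_sets_subset[OF sL])
  then have "sets borel \<subseteq> ?L"
    by (simp add: borel_eq_closed sets_measure_of)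
  then have "measure_space UNIV (sets borel) (hausdorff_measure n :: 'a set \<Rightarrow> ennreal)"
    using measure_down[OF L] sets.sigma_algebra_axioms[of "borel :: 'a measure"] by simp
  then show ?thesis
    unfolding hausdorff_borel_def measure_space_def using A sets.sigma_sets_eq[of "borel :: 'a measure"]
    by (intro emeasure_measure_of_sigma) (auto simp: sets.sigma_algebra_axioms)
qed

text \<open>The image of a cover is a cover whose diameters grew at most by the factor
  \<open>L\<close>. With \<open>L = 1\<close> this yields translation invariance; with scalar
  multiples it carries finiteness from a set to its multiples.\<close>

lemma hausdorff_measure_lipschitz:
  fixes f :: "'a::metric_space \<Rightarrow> 'b::metric_space"
  assumes L: "L > 0" and lip: "\<And>x y. dist (f x) (f y) \<le> L * dist x y"
  shows "hausdorff_measure n (f ` E) \<le> ennreal (L ^ n) * hausdorff_measure n E"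
  unfolding hausdorff_measure_def[of n "f ` E"]
proof (rule SUP_least)
  fix \<delta> :: real assume "\<delta> \<in> {0<..}"
  then have \<delta>: "\<delta> > 0" by simp
  let ?cov = "\<lambda>\<delta> E. {C. E \<subseteq> (\<Union>i::nat. C i) \<and> (\<forall>i. bounded (C i) \<and> diameter (C i) \<le> \<delta>)}"
  have bnd: "bounded (f ` C)" if C: "bounded C" for C
  proof -
    obtain a M where "\<And>x. x \<in> C \<Longrightarrow> dist a x \<le> M" using C by (auto simp: bounded_def)
    then have "dist (f a) (f x) \<le> L * M" if "x \<in> C" for x
      using lip[of a x] that L by (meson mult_left_mono order_trans less_imp_le)
    then show ?thesis by (auto simp: bounded_def)
  qed
  have diam: "diameter (f ` C) \<le> L * diameter C" if C: "bounded C" for C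
  proof (cases "C = {}")
    case False
    have "dist (f x) (f y) \<le> L * diameter C" if "x \<in> C" "y \<in> C" for x y
      using lip[of x y] diameter_bounded_bound[OF C that] L
      by (meson mult_left_mono order_trans less_imp_le)
    then show ?thesis using False by (auto simp: diameter_def intro!: cSUP_least)
  qed (simp add: diameter_def)
  have weight: "hausdorff_weight n (f ` C) \<le> ennreal (L ^ n) * hausdorff_weight n C" if C: "bounded C" for C
  proof -
    have "(diameter (f ` C) / 2) ^ n \<le> (L * (diameter C / 2)) ^ n"
      using diam[OF C] diameter_ge_0[OF bnd[OF C]] by (intro power_mono) auto
    then have "(diameter (f ` C) / 2) ^ n \<le> L ^ n * (diameter C / 2) ^ n"
      unfolding power_mult_distrib .
    then have "unit_ball_vol (real n) * (diameter (f ` C) / 2) ^ n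
        \<le> unit_ball_vol (real n) * (L ^ n * (diameter C / 2) ^ n)"
      by (rule mult_left_mono) simp
    also have "\<dots> = L ^ n * (unit_ball_vol (real n) * (diameter C / 2) ^ n)"
      by (rule mult.left_commute)
    finally have "unit_ball_vol (real n) * (diameter (f ` C) / 2) ^ n
        \<le> L ^ n * (unit_ball_vol (real n) * (diameter C / 2) ^ n)" .
    then show ?thesis
      using L by (auto simp: hausdorff_weight_def ennreal_mult'[symmetric] intro!: ennreal_leI)
  qed
  have "hausdorff_content n \<delta> (f ` E) \<le> ennreal (L ^ n) * hausdorff_content n (\<delta> / L) E"
  proof -
    have le: "hausdorff_content n \<delta> (f ` E) \<le> ennreal (L ^ n) * (\<Sum>i. hausdorff_weight n (C i))"
      if C: "C \<in> ?cov (\<delta> / L) E" for C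
    proof -
      have "hausdorff_content n \<delta> (f ` E) \<le> (\<Sum>i. hausdorff_weight n (f ` C i))"
        unfolding hausdorff_content_def
      proof (rule INF_lower, safe)
        fix x assume "x \<in> E" then show "f x \<in> (\<Union>i. f ` C i)" using C by blast
      next
        fix i
        show "bounded (f ` C i)" using C bnd by auto
        have "diameter (f ` C i) \<le> L * (\<delta> / L)"
          using C L by (intro order_trans[OF diam] mult_left_mono) auto
        then show "diameter (f ` C i) \<le> \<delta>" using L by simp
      qed
      also have "\<dots> \<le> (\<Sum>i. ennreal (L ^ n) * hausdorff_weight n (C i))"
        using C by (intro suminf_le weight) auto
      finally show ?thesis by simp
    qed
    \<comment> \<open>The constant is moved to the left-hand side so that the infimum over covers
      can be treated by \<open>INF_greatest\<close>, and moved back afterwards.\<close>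
    have cancel: "ennreal (1 / L ^ n) * (ennreal (L ^ n) * x) = x"
      "ennreal (L ^ n) * (ennreal (1 / L ^ n) * x) = x" for x
      using L by (simp_all add: mult.assoc[symmetric] ennreal_mult'[symmetric])
    have "ennreal (1 / L ^ n) * hausdorff_content n \<delta> (f ` E) \<le> (\<Sum>i. hausdorff_weight n (C i))"
      if "C \<in> ?cov (\<delta> / L) E" for C
    proof -
      have "ennreal (1 / L ^ n) * hausdorff_content n \<delta> (f ` E)
          \<le> ennreal (1 / L ^ n) * (ennreal (L ^ n) * (\<Sum>i. hausdorff_weight n (C i)))"
        using le[OF that] by (rule mult_left_mono) simp
      also have "\<dots> = (\<Sum>i. hausdorff_weight n (C i))"
        by (rule cancel(1))
      finally show ?thesis .
    qed
    then have "ennreal (1 / L ^ n) * hausdorff_content n \<delta> (f ` E) \<le> hausdorff_content n (\<delta> / L) E"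
      unfolding hausdorff_content_def[of n "\<delta> / L"] by (rule INF_greatest)
    then have "ennreal (L ^ n) * (ennreal (1 / L ^ n) * hausdorff_content n \<delta> (f ` E))
        \<le> ennreal (L ^ n) * hausdorff_content n (\<delta> / L) E"
      by (rule mult_left_mono) simp
    then show ?thesis by (simp only: cancel(2))
  qed
  also have "\<dots> \<le> ennreal (L ^ n) * hausdorff_measure n E"
    unfolding hausdorff_measure_def using \<delta> L by (intro mult_left_mono SUP_upper) auto
  finally show "hausdorff_content n \<delta> (f ` E) \<le> ennreal (L ^ n) * hausdorff_measure n E" .
qed

section \<open>Invariant measures\<close>

text \<open>Both sides are \<open>\<integral>\<integral> indicator E (x + y) * indicator F y\<close>, integrated in the two possible orders.\<close>

lemma invariant_measure_exchange:
  fixes M M' :: "'a::euclidean_space measure"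
  assumes M [measurable_cong]: "sets M = sets borel" and M' [measurable_cong]: "sets M' = sets borel"
    and "sigma_finite_measure M" "sigma_finite_measure M'"
    and AE: "AE x in M. x \<in> N" "AE x in M'. x \<in> N"
    and inv: "\<And>x A. x \<in> N \<Longrightarrow> A \<in> sets borel \<Longrightarrow> emeasure M ((+) x -` A) = emeasure M A"
    and inv': "\<And>x A. x \<in> N \<Longrightarrow> A \<in> sets borel \<Longrightarrow> emeasure M' ((+) x -` A) = emeasure M' A"
    and N: "\<And>x. x \<in> N \<Longrightarrow> - x \<in> N"
    and E [measurable]: "E \<in> sets borel" and F [measurable]: "F \<in> sets borel"
  shows "emeasure M E * emeasure M' F = emeasure M' E * emeasure M (uminus -` F)"
proof -
  interpret A: sigma_finite_measure M by fact
  interpret B: sigma_finite_measure M' by fact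
  interpret P: pair_sigma_finite M M' ..
  have sp: "space M = UNIV" "space M' = UNIV"
    using sets_eq_imp_space_eq[OF M] sets_eq_imp_space_eq[OF M'] by simp_all
  have vim [measurable]: "(+) x -` A \<in> sets borel" "uminus -` A \<in> sets borel" if "A \<in> sets borel" for x and A :: "'a set"
    using measurable_sets[of "(+) x" borel borel A] measurable_sets[of uminus borel borel A] that
    by simp_all
  have ind: "(\<integral>\<^sup>+x. indicator A (x + y) \<partial>M) = emeasure M A" if "y \<in> N" "A \<in> sets borel" for y A
  proof -
    have "(\<integral>\<^sup>+x. indicator A (x + y) \<partial>M) = (\<integral>\<^sup>+x. indicator ((+) y -` A) x \<partial>M)"
      by (intro nn_integral_cong) (auto simp: indicator_def add.commute)
    also have "\<dots> = emeasure M A"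
      using that inv[of y A] vim(1)[of A y] by (simp add: M)
    finally show ?thesis .
  qed
  have trans: "(\<integral>\<^sup>+y. g (x + y) \<partial>M') = (\<integral>\<^sup>+y. g y \<partial>M')"
    if x: "x \<in> N" and g [measurable]: "g \<in> borel_measurable borel" for x and g :: "'a \<Rightarrow> ennreal"
  proof -
    have "distr M' borel ((+) x) = M'"
    proof (rule measure_eqI)
      show "sets (distr M' borel ((+) x)) = sets M'" by (simp add: M')
      fix A assume "A \<in> sets (distr M' borel ((+) x))"
      then show "emeasure (distr M' borel ((+) x)) A = emeasure M' A"
        using inv'[OF x, of A] by (simp add: emeasure_distr sp)
    qed
    then have "(\<integral>\<^sup>+y. g y \<partial>M') = (\<integral>\<^sup>+y. g y \<partial>(distr M' borel ((+) x)))" by simp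
    also have "\<dots> = (\<integral>\<^sup>+y. g (x + y) \<partial>M')"
      by (rule nn_integral_distr) auto
    finally show ?thesis ..
  qed
  have "emeasure M E * emeasure M' F = (\<integral>\<^sup>+y. emeasure M E * indicator F y \<partial>M')"
    by (simp add: nn_integral_cmult)
  also have "\<dots> = (\<integral>\<^sup>+y. \<integral>\<^sup>+x. indicator E (x + y) * indicator F y \<partial>M \<partial>M')"
    using AE(2) by (intro nn_integral_cong_AE) (auto simp: nn_integral_multc ind elim!: eventually_mono)
  also have "\<dots> = (\<integral>\<^sup>+x. \<integral>\<^sup>+y. indicator E (x + y) * indicator F y \<partial>M' \<partial>M)"
    by (rule P.Fubini') measurable
  \<comment> \<open>The substitution \<open>z = x + y\<close> in the inner integral, valid because
    almost every \<open>x\<close> lies in \<open>N\<close> and \<open>M'\<close> is invariant under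
    such translations.\<close>
  also have "\<dots> = (\<integral>\<^sup>+x. \<integral>\<^sup>+z. indicator E z * indicator F (z - x) \<partial>M' \<partial>M)"
  proof (rule nn_integral_cong_AE, use AE(1) in eventually_elim)
    case (elim x)
    then show ?case
      using trans[of x "\<lambda>z. indicator E z * indicator F (z - x)"] by simp
  qed
  also have "\<dots> = (\<integral>\<^sup>+z. \<integral>\<^sup>+x. indicator E z * indicator F (z - x) \<partial>M \<partial>M')"
    by (rule P.Fubini'[symmetric]) measurable
  also have "\<dots> = (\<integral>\<^sup>+z. emeasure M (uminus -` F) * indicator E z \<partial>M')"
  proof (rule nn_integral_cong_AE, use AE(2) in eventually_elim)
    case (elim z)
    have "(\<integral>\<^sup>+x. indicator F (z - x) \<partial>M) = (\<integral>\<^sup>+x. indicator (uminus -` F) (x + - z) \<partial>M)"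
      by (intro nn_integral_cong) (auto simp: indicator_def)
    also have "\<dots> = emeasure M (uminus -` F)"
      by (rule ind) (use elim N vim in auto)
    finally show ?case by (simp add: nn_integral_cmult mult.commute)
  qed
  also have "\<dots> = emeasure M' E * emeasure M (uminus -` F)"
    by (subst nn_integral_cmult) (simp_all add: mult.commute)
  finally show ?thesis .
qed

section \<open>Triangular changes of variables\<close>

interpretation lborel_product: product_sigma_finite "\<lambda>_. lborel :: real measure"
  by standard

lemma nn_integral_lborel_shift:
  fixes f :: "real \<Rightarrow> ennreal"
  assumes "f \<in> borel_measurable borel"
  shows "(\<integral>\<^sup>+t. f (t + c) \<partial>lborel) = (\<integral>\<^sup>+t. f t \<partial>lborel)"
  using nn_integral_real_affine[OF assms, of 1 c] by (simp add: add.commute)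

text \<open>A coordinate of maximal rank influences no shift, and its own shift depends only on the
  others. Integrating over it first therefore reduces to translation invariance on the line, and the
  remaining map is again triangular. Ranks may coincide; coordinates of equal rank do not influence
  each other.\<close>

lemma nn_integral_PiM_triangular:
  fixes rank :: "'i \<Rightarrow> nat" and \<phi> :: "'i \<Rightarrow> ('i \<Rightarrow> real) \<Rightarrow> real"
  assumes "finite I"
    and "\<And>i. i \<in> I \<Longrightarrow> \<phi> i \<in> borel_measurable (PiM I (\<lambda>_. lborel))"
    and "\<And>i x y. i \<in> I \<Longrightarrow> (\<And>j. j \<in> I \<Longrightarrow> rank j < rank i \<Longrightarrow> x j = y j) \<Longrightarrow> \<phi> i x = \<phi> i y"
    and "f \<in> borel_measurable (PiM I (\<lambda>_. lborel))"
  shows "(\<integral>\<^sup>+x. f (\<lambda>i\<in>I. x i + \<phi> i x) \<partial>PiM I (\<lambda>_. lborel)) = (\<integral>\<^sup>+x. f x \<partial>PiM I (\<lambda>_. lborel))"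
  using assms
proof (induction I arbitrary: \<phi> f rule: finite_ranking_induct[where f = rank])
  case empty
  show ?case by (intro nn_integral_cong) (auto simp: space_PiM)
next
  case (insert i J)
  \<comment> \<open>\<open>finite_ranking_induct\<close> adds an element of maximal rank without
    saying that it is new.\<close>
  show ?case
  proof (cases "i \<in> J")
    case True
    then have eq: "insert i J = J" by auto
    show ?thesis
      unfolding eq by (rule insert.IH) (fact insert.prems[unfolded eq])+
  next
    case False
    note insert = insert this
    let ?P = "\<lambda>I. PiM I (\<lambda>_. lborel :: real measure)"
    note [measurable] = insert.prems(3)
    have [measurable]: "\<phi> j \<in> borel_measurable (?P (insert i J))" if "j \<in> insert i J" for j
      using insert.prems(1) that .
    have upd [measurable]: "(\<lambda>x. x(i := 0)) \<in> measurable (?P J) (?P (insert i J))"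
      by (rule measurable_fun_upd[where J = J]) auto
    have upd2 [measurable]: "(\<lambda>(x, t). x(i := t)) \<in> measurable (?P J \<Otimes>\<^sub>M lborel) (?P (insert i J))"
      by (rule measurable_add_dim)
    \<comment> \<open>The value \<open>0\<close> is arbitrary: each shift reads only ranks strictly
      below its own, hence never the coordinate \<open>i\<close> of maximal rank.\<close>
    define \<phi>' where "\<phi>' j x = \<phi> j (x(i := 0))" for j x
    have \<phi>'m: "\<phi>' j \<in> borel_measurable (?P J)" if "j \<in> insert i J" for j
      unfolding \<phi>'_def by (rule measurable_compose[OF upd insert.prems(1)[OF that]])
    have \<phi>eq: "\<phi> j (x(i := t)) = \<phi>' j x" if "j \<in> insert i J" for j x t
      unfolding \<phi>'_def using that insert(1) insert(2)[of j] by (intro insert.prems(2)) (auto simp: not_less)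
    define g where "g y = (\<integral>\<^sup>+t. f (y(i := t)) \<partial>lborel)" for y
    have fm: "(\<lambda>(x, t). f (x(i := t))) \<in> borel_measurable (?P J \<Otimes>\<^sub>M lborel)"
      using measurable_compose[OF upd2 insert.prems(3)] by (simp add: case_prod_unfold)
    have gm: "g \<in> borel_measurable (?P J)"
      unfolding g_def using lborel.borel_measurable_nn_integral[OF fm] .
    have psi: "(\<lambda>x. \<lambda>j\<in>insert i J. x j + \<phi> j x) \<in> measurable (?P (insert i J)) (?P (insert i J))"
      by (rule measurable_restrict) (auto intro!: borel_measurable_add measurable_component_singleton)
    have "(\<integral>\<^sup>+x. f (\<lambda>j\<in>insert i J. x j + \<phi> j x) \<partial>?P (insert i J))
        = (\<integral>\<^sup>+x. \<integral>\<^sup>+t. f (\<lambda>j\<in>insert i J. (x(i := t)) j + \<phi> j (x(i := t))) \<partial>lborel \<partial>?P J)"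
      using insert(1,2) False measurable_compose[OF psi insert.prems(3)]
      by (intro lborel_product.product_nn_integral_insert) auto
    also have "\<dots> = (\<integral>\<^sup>+x. g (\<lambda>j\<in>J. x j + \<phi>' j x) \<partial>?P J)"
    proof (rule nn_integral_cong)
      fix x assume x: "x \<in> space (?P J)"
      let ?y = "\<lambda>j\<in>J. x j + \<phi>' j x"
      have y: "?y \<in> space (?P J)" by (simp add: space_PiM)
      have "(\<lambda>j\<in>insert i J. (x(i := t)) j + \<phi> j (x(i := t))) = ?y(i := t + \<phi>' i x)" for t
        using insert(1,2) False by (auto simp: fun_eq_iff \<phi>eq restrict_def)
      moreover have "(\<lambda>t. f (?y(i := t))) \<in> borel_measurable borel"
        using measurable_compose[OF measurable_Pair1'[OF y] fm] by simp
      ultimately show "(\<integral>\<^sup>+t. f (\<lambda>j\<in>insert i J. (x(i := t)) j + \<phi> j (x(i := t))) \<partial>lborel) = g ?y"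
        using nn_integral_lborel_shift[of "\<lambda>t. f (?y(i := t))"] by (simp add: g_def)
    qed
    also have "\<dots> = (\<integral>\<^sup>+x. g x \<partial>?P J)"
    proof (rule insert.IH)
      fix j and x y :: "'i \<Rightarrow> real"
      assume "j \<in> J" "\<And>k. k \<in> J \<Longrightarrow> rank k < rank j \<Longrightarrow> x k = y k"
      then show "\<phi>' j x = \<phi>' j y"
        unfolding \<phi>'_def by (intro insert.prems(2)) auto
    qed (auto intro: \<phi>'m gm)
    also have "\<dots> = (\<integral>\<^sup>+x. f x \<partial>?P (insert i J))"
      unfolding g_def using insert(1,2) False insert.prems(3)
      by (intro lborel_product.product_nn_integral_insert[symmetric]) auto
    finally show ?thesis .
  qed
qed

section \<open>The Prekopa--Leindler inequality\<close>

lemma emeasure_lborel_affine: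
  fixes D :: "real set"
  assumes D: "D \<in> sets borel" and "c \<noteq> 0"
  shows "emeasure lborel ((\<lambda>x. t + c * x) -` D) = ennreal (1 / \<bar>c\<bar>) * emeasure lborel D"
proof -
  have V: "(\<lambda>x. t + c * x) -` D \<in> sets borel"
    using measurable_sets[of "\<lambda>x. t + c * x" borel borel D] D by simp
  have "emeasure lborel D = ennreal \<bar>c\<bar> * (\<integral>\<^sup>+x. indicator D (t + c * x) \<partial>lborel)"
    using nn_integral_real_affine[of "indicator D" c t] D \<open>c \<noteq> 0\<close> by simp
  also have "(\<integral>\<^sup>+x. indicator D (t + c * x) \<partial>lborel) = (\<integral>\<^sup>+x. indicator ((\<lambda>x. t + c * x) -` D) x \<partial>lborel)"
    by (intro nn_integral_cong) (auto simp: indicator_def)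
  also have "\<dots> = emeasure lborel ((\<lambda>x. t + c * x) -` D)"
    using V by simp
  finally show ?thesis
    using \<open>c \<noteq> 0\<close> by (simp add: mult.assoc[symmetric] ennreal_mult'[symmetric])
qed

text \<open>If \<open>A\<close> has a maximum, one segment is all of \<open>A\<close>. Otherwise the
  rationals lying below some point of \<open>A\<close> are enumerated, and their running maxima
  \<open>s k\<close> give increasing segments that exhaust \<open>A\<close>. The bound is asked only
  for cuts at points of \<open>A\<close>, since only such points can be averaged with points of the
  other set.\<close>

lemma emeasure_real_le_initial_segments:
  fixes A :: "real set"
  assumes A: "A \<in> sets borel" "A \<noteq> {}"
    and le: "\<And>a. a \<in> A \<Longrightarrow> emeasure lborel (A \<inter> {..a}) \<le> c"
  shows "emeasure lborel A \<le> c"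
proof (cases "\<exists>m\<in>A. \<forall>x\<in>A. x \<le> m")
  case True
  then obtain m where "m \<in> A" "A \<inter> {..m} = A" by auto
  then show ?thesis using le[of m] by simp
next
  case False
  define Q where "Q = {q \<in> \<rat>. \<exists>a\<in>A. q \<le> a}"
  have Q: "countable Q" "Q \<noteq> {}"
  proof -
    show "countable Q" unfolding Q_def by (rule countable_subset[OF _ countable_rat]) auto
    obtain a where "a \<in> A" using A by auto
    moreover obtain q where "q \<in> \<rat>" "q < a" using Rats_dense_in_real[of "a - 1" a] by auto
    ultimately show "Q \<noteq> {}" unfolding Q_def by force
  qed
  define q where "q = from_nat_into Q"
  have q: "q k \<in> Q" for k unfolding q_def by (rule from_nat_into[OF Q(2)])
  define s where "s k = Max (q ` {..k})" for k
  have sQ: "s k \<in> Q" for k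
  proof -
    have "s k \<in> q ` {..k}" unfolding s_def by (rule Max_in) auto
    then show ?thesis using q by auto
  qed
  have "incseq (\<lambda>k. A \<inter> {..s k})"
  proof (rule incseq_SucI)
    fix k
    have "s k \<le> s (Suc k)" unfolding s_def by (rule Max_mono) auto
    then show "A \<inter> {..s k} \<subseteq> A \<inter> {..s (Suc k)}" by auto
  qed
  then have "(SUP k. emeasure lborel (A \<inter> {..s k})) = emeasure lborel (\<Union>k. A \<inter> {..s k})"
    using A by (intro SUP_emeasure_incseq) auto
  also have "(\<Union>k. A \<inter> {..s k}) = A"
  proof -
    have "\<exists>k. x \<le> s k" if x: "x \<in> A" for x
    proof -
      obtain a where a: "a \<in> A" "x < a" using False x by (auto simp: not_le)
      obtain p where "p \<in> \<rat>" "x < p" "p < a" using Rats_dense_in_real[OF a(2)] by auto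
      then have p: "p \<in> Q" using a by (auto simp: Q_def intro!: bexI[of _ a])
      obtain k where "q k = p" using from_nat_into_surj[OF Q(1) p] by (auto simp: q_def)
      moreover have "q k \<le> s k" unfolding s_def by (rule Max_ge) auto
      ultimately show ?thesis using \<open>x < p\<close> by (intro exI[of _ k]) simp
    qed
    then show ?thesis by auto
  qed
  finally have "emeasure lborel A = (SUP k. emeasure lborel (A \<inter> {..s k}))" ..
  also have "\<dots> \<le> c"
  proof (rule SUP_least)
    fix k
    obtain a where a: "a \<in> A" "s k \<le> a" using sQ[of k] by (auto simp: Q_def)
    have "emeasure lborel (A \<inter> {..s k}) \<le> emeasure lborel (A \<inter> {..a})"
      using a A by (intro emeasure_mono) auto
    also have "\<dots> \<le> c" using a by (intro le)
    finally show "emeasure lborel (A \<inter> {..s k}) \<le> c" .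
  qed
  finally show ?thesis .
qed

lemma emeasure_real_le_final_segments:
  fixes A :: "real set"
  assumes A: "A \<in> sets borel" "A \<noteq> {}"
    and le: "\<And>a. a \<in> A \<Longrightarrow> emeasure lborel (A \<inter> {a..}) \<le> c"
  shows "emeasure lborel A \<le> c"
proof -
  have refl: "emeasure lborel (uminus -` D) = emeasure lborel D" if "D \<in> sets borel" for D :: "real set"
    using emeasure_lborel_affine[OF that, of "-1" 0] by (simp add: vimage_def)
  have "emeasure lborel (uminus -` A) \<le> c"
  proof (rule emeasure_real_le_initial_segments)
    show "uminus -` A \<in> sets borel"
      using measurable_sets[of uminus borel borel A] A by simp
    obtain a where "a \<in> A" using A by auto
    then have "- a \<in> uminus -` A" by simp
    then show "uminus -` A \<noteq> {}" by blast
    fix a assume "a \<in> uminus -` A"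
    then have "emeasure lborel (A \<inter> {-a..}) \<le> c" by (intro le) simp
    moreover have "uminus -` A \<inter> {..a} = uminus -` (A \<inter> {-a..})" by auto
    ultimately show "emeasure lborel (uminus -` A \<inter> {..a}) \<le> c"
      using refl[of "A \<inter> {-a..}"] A by simp
  qed
  then show ?thesis using refl[OF A(1)] by simp
qed

text \<open>For \<open>a\<close> in \<open>A\<close> and \<open>b\<close> in \<open>B\<close> with
  midpoint \<open>m\<close>, averaging \<open>A \<inter> {..a}\<close> with \<open>b\<close> lands
  in \<open>C\<close> below \<open>m\<close>, and averaging \<open>B \<inter> {b..}\<close> with
  \<open>a\<close> lands in \<open>C\<close> above \<open>m\<close>. These pieces of
  \<open>C\<close> share at most the null set \<open>{m}\<close>. Letting \<open>a\<close> and
  \<open>b\<close> exhaust the two sets gives the claim.\<close>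

lemma brunn_minkowski_real:
  fixes A B C :: "real set"
  assumes A: "A \<in> sets borel" "A \<noteq> {}" and B: "B \<in> sets borel" "B \<noteq> {}" and C: "C \<in> sets borel"
    and mid: "\<And>x y. x \<in> A \<Longrightarrow> y \<in> B \<Longrightarrow> (x + y) / 2 \<in> C"
  shows "emeasure lborel A + emeasure lborel B \<le> 2 * emeasure lborel C"
proof -
  have half: "emeasure lborel S \<le> 2 * emeasure lborel D"
    if "S \<in> sets borel" "D \<in> sets borel" "\<And>x. x \<in> S \<Longrightarrow> (x + z) / 2 \<in> D" for S D :: "real set" and z
  proof -
    have D: "(\<lambda>x. z / 2 + (1 / 2) * x) -` D \<in> sets borel"
      using measurable_sets[of "\<lambda>x. z / 2 + (1 / 2) * x" borel borel D] that(2) by simp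
    have "S \<subseteq> (\<lambda>x. z / 2 + (1 / 2) * x) -` D"
      using that(3) by (auto simp: field_simps)
    then have "emeasure lborel S \<le> emeasure lborel ((\<lambda>x. z / 2 + (1 / 2) * x) -` D)"
      using D by (intro emeasure_mono) auto
    also have "\<dots> = 2 * emeasure lborel D"
      using emeasure_lborel_affine[OF that(2), of "1/2" "z/2"] by simp
    finally show ?thesis .
  qed
  have main: "emeasure lborel (A \<inter> {..a}) + emeasure lborel (B \<inter> {b..}) \<le> 2 * emeasure lborel C"
    if "a \<in> A" "b \<in> B" for a b
  proof -
    define m where "m = (a + b) / 2"
    have "emeasure lborel (B \<inter> {b..}) \<le> 2 * emeasure lborel (C \<inter> {m..})"
      using A B C that mid[OF that(1)] by (intro half[of _ _ a]) (auto simp: m_def add.commute)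
    also have "emeasure lborel (C \<inter> {m..}) \<le> emeasure lborel (C \<inter> {m<..} \<union> {m})"
      using C by (intro emeasure_mono) auto
    also have "\<dots> \<le> emeasure lborel (C \<inter> {m<..}) + emeasure lborel {m}"
      using C by (intro emeasure_subadditive) auto
    finally have b: "emeasure lborel (B \<inter> {b..}) \<le> 2 * emeasure lborel (C \<inter> {m<..})"
      by (simp add: mult_left_mono)
    have a: "emeasure lborel (A \<inter> {..a}) \<le> 2 * emeasure lborel (C \<inter> {..m})"
      using A B C that mid[OF _ that(2)] by (intro half[of _ _ b]) (auto simp: m_def)
    have "emeasure lborel (C \<inter> {..m}) + emeasure lborel (C \<inter> {m<..})
        = emeasure lborel (C \<inter> {..m} \<union> C \<inter> {m<..})"
      using C by (intro plus_emeasure) auto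
    also have "C \<inter> {..m} \<union> C \<inter> {m<..} = C" by auto
    finally have "2 * emeasure lborel (C \<inter> {..m}) + 2 * emeasure lborel (C \<inter> {m<..}) = 2 * emeasure lborel C"
      by (simp add: distrib_left[symmetric])
    then show ?thesis using add_mono[OF a b] by simp
  qed
  have seg: "emeasure lborel A + emeasure lborel (B \<inter> {b..}) \<le> 2 * emeasure lborel C"
    if b: "b \<in> B" for b
  proof -
    have "emeasure lborel A \<le> 2 * emeasure lborel C - emeasure lborel (B \<inter> {b..})"
      using main[OF _ b] by (intro emeasure_real_le_initial_segments[OF A]) (simp add: ennreal_le_minus_iff)
    \<comment> \<open>Subtraction in \<open>ennreal\<close> is truncated; this bound excludes the
      case in which \<open>ennreal_le_minus_iff\<close> holds only because of truncation.\<close>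
    moreover obtain a where "a \<in> A" using A by auto
    then have "emeasure lborel (B \<inter> {b..}) \<le> 2 * emeasure lborel C"
      by (intro order_trans[OF _ main[OF _ b]]) auto
    ultimately show ?thesis by (auto simp: ennreal_le_minus_iff)
  qed
  have "emeasure lborel B \<le> 2 * emeasure lborel C - emeasure lborel A"
    using seg by (intro emeasure_real_le_final_segments[OF B]) (simp add: ennreal_le_minus_iff add.commute)
  moreover obtain b where "b \<in> B" using B by auto
  then have "emeasure lborel A \<le> 2 * emeasure lborel C"
    by (intro order_trans[OF _ seg]) auto
  ultimately show ?thesis by (auto simp: ennreal_le_minus_iff add.commute)
qed

text \<open>Truncation at \<open>1\<close> restricts the levels to \<open>{0<..<1}\<close>. These
  are the levels at which functions with supremum \<open>1\<close> have nonempty superlevel sets, as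
  the one-dimensional Brunn--Minkowski inequality demands.\<close>

lemma nn_integral_min_one_layer_cake:
  fixes f :: "real \<Rightarrow> ennreal"
  assumes [measurable]: "f \<in> borel_measurable borel"
  shows "(\<integral>\<^sup>+x. min 1 (f x) \<partial>lborel)
    = (\<integral>\<^sup>+t. indicator {0<..<1} t * emeasure lborel {x. ennreal t < f x} \<partial>lborel)"
proof -
  have "min 1 (f x) = (\<integral>\<^sup>+t. indicator {0<..<1} t * indicator {x. ennreal t < f x} x \<partial>lborel)" for x
  proof -
    obtain r where r: "min 1 (f x) = ennreal r" "0 \<le> r" "r \<le> 1"
      using min.cobounded1[of 1 "f x"] by (cases "min 1 (f x)") (auto simp: top_unique)
    have "(\<integral>\<^sup>+t. indicator {0<..<1} t * indicator {x. ennreal t < f x} x \<partial>lborel)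
        = (\<integral>\<^sup>+t. indicator {0<..<r} t \<partial>lborel)"
    proof (intro nn_integral_cong)
      fix t :: real
      have "ennreal t < f x \<longleftrightarrow> t < r" if "0 < t" "t < 1"
      proof -
        have "ennreal t < f x \<longleftrightarrow> ennreal t < min 1 (f x)"
          using that by (simp add: ennreal_1[symmetric] del: ennreal_1) (simp add: ennreal_less_iff)
        also have "\<dots> \<longleftrightarrow> t < r" using that r by (simp add: ennreal_less_iff)
        finally show ?thesis .
      qed
      then show "indicator {0<..<1} t * indicator {x. ennreal t < f x} x = (indicator {0<..<r} t :: ennreal)"
        using r by (auto simp: indicator_def)
    qed
    then show ?thesis using r by simp
  qed
  then have "(\<integral>\<^sup>+x. min 1 (f x) \<partial>lborel)
      = (\<integral>\<^sup>+x. \<integral>\<^sup>+t. indicator {0<..<1} t * indicator {x. ennreal t < f x} x \<partial>lborel \<partial>lborel)"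
    by simp
  also have "\<dots> = (\<integral>\<^sup>+t. \<integral>\<^sup>+x. indicator {0<..<1} t * indicator {x. ennreal t < f x} x \<partial>lborel \<partial>lborel)"
    by (rule lborel_pair.Fubini') measurable
  also have "\<dots> = (\<integral>\<^sup>+t. indicator {0<..<1} t * emeasure lborel {x. ennreal t < f x} \<partial>lborel)"
    by (simp add: nn_integral_cmult)
  finally show ?thesis .
qed

lemma mult_le_square_of_add_le:
  fixes a b c :: ennreal
  assumes "a + b \<le> 2 * c"
  shows "a * b \<le> c\<^sup>2"
proof (cases "c = \<infinity>")
  case False
  then obtain z where z: "c = ennreal z" "z \<ge> 0" by (cases c) auto
  then have "a + b \<le> ennreal (2 * z)" using assms by (simp add: ennreal_mult')
  then have "a + b < \<infinity>" by (rule le_less_trans) simp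
  then obtain x y where xy: "a = ennreal x" "b = ennreal y" "x \<ge> 0" "y \<ge> 0"
    by (cases a; cases b) auto
  then have "x + y \<le> 2 * z"
    using \<open>a + b \<le> ennreal (2 * z)\<close> z by (simp flip: ennreal_plus)
  then have "(x + y)\<^sup>2 \<le> (2 * z)\<^sup>2"
    using xy by (intro power_mono) auto
  moreover have "0 \<le> (x - y)\<^sup>2" by simp
  ultimately have "x * y \<le> z\<^sup>2" by (simp add: power2_eq_square algebra_simps)
  then show ?thesis
    using xy z by (simp add: ennreal_mult'[symmetric] ennreal_power)
qed (simp add: power2_eq_square)

text \<open>With both suprema equal to \<open>1\<close>, midpoints of points where
  \<open>f > t\<close> and \<open>g > t\<close> have \<open>h > t\<close>. Brunn--Minkowski at every
  level integrates to an additive inequality, and the arithmetic-geometric mean inequality turns it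
  into the multiplicative one.\<close>

lemma prekopa_leindler_real_normalized:
  fixes f g h :: "real \<Rightarrow> ennreal"
  assumes [measurable]: "f \<in> borel_measurable borel" "g \<in> borel_measurable borel" "h \<in> borel_measurable borel"
    and le: "\<And>x y. f x * g y \<le> (h ((x + y) / 2))\<^sup>2"
    and sup: "(SUP x. f x) = 1" "(SUP x. g x) = 1"
  shows "(\<integral>\<^sup>+x. f x \<partial>lborel) * (\<integral>\<^sup>+x. g x \<partial>lborel) \<le> (\<integral>\<^sup>+x. h x \<partial>lborel)\<^sup>2"
proof (rule mult_le_square_of_add_le)
  let ?m = "\<lambda>f. \<lambda>t. emeasure lborel {x :: real. ennreal t < f x}"
  have 1: "min 1 (f x) = f x" "min 1 (g x) = g x" for x
    using sup by (metis UNIV_I SUP_upper min.absorb2)+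
  have lev: "?m f t + ?m g t \<le> 2 * ?m h t" if t: "0 < t" "t < 1" for t
  proof (rule brunn_minkowski_real)
    have "ennreal t < 1" using t by (simp add: ennreal_1[symmetric] ennreal_less_iff del: ennreal_1)
    then have "ennreal t < (SUP x. f x)" "ennreal t < (SUP x. g x)" using sup by auto
    then show "{x. ennreal t < f x} \<noteq> {}" "{x. ennreal t < g x} \<noteq> {}"
      by (auto simp: less_SUP_iff)
    fix x y assume "x \<in> {x. ennreal t < f x}" "y \<in> {x. ennreal t < g x}"
    then have xy: "ennreal t < f x" "ennreal t < g y" by auto
    then have "ennreal t * ennreal t < ennreal t * g y"
      using t by (intro ennreal_mult_strict_left_mono) auto
    also have "\<dots> \<le> f x * g y"
      using xy by (intro mult_right_mono) auto
    finally have less: "(ennreal t)\<^sup>2 < (h ((x + y) / 2))\<^sup>2"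
      using le[of x y] by (simp only: power2_eq_square order_less_le_trans)
    show "(x + y) / 2 \<in> {x. ennreal t < h x}"
    proof (rule ccontr)
      assume "\<not> ?thesis"
      then have "(h ((x + y) / 2))\<^sup>2 \<le> (ennreal t)\<^sup>2" by (intro power_mono) auto
      then show False using less by simp
    qed
  qed measurable
  have "(\<integral>\<^sup>+x. f x \<partial>lborel) + (\<integral>\<^sup>+x. g x \<partial>lborel)
      = (\<integral>\<^sup>+x. min 1 (f x) \<partial>lborel) + (\<integral>\<^sup>+x. min 1 (g x) \<partial>lborel)"
    by (simp add: 1)
  also have "\<dots> = (\<integral>\<^sup>+t. indicator {0<..<1} t * ?m f t + indicator {0<..<1} t * ?m g t \<partial>lborel)"
    unfolding nn_integral_min_one_layer_cake[OF assms(1)] nn_integral_min_one_layer_cake[OF assms(2)]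
    by (rule nn_integral_add[symmetric]) measurable
  also have "\<dots> \<le> (\<integral>\<^sup>+t. 2 * (indicator {0<..<1} t * ?m h t) \<partial>lborel)"
    by (intro nn_integral_mono) (auto simp: indicator_def lev)
  also have "\<dots> = 2 * (\<integral>\<^sup>+x. min 1 (h x) \<partial>lborel)"
    unfolding nn_integral_min_one_layer_cake[OF assms(3)] by (rule nn_integral_cmult) measurable
  also have "\<dots> \<le> 2 * (\<integral>\<^sup>+x. h x \<partial>lborel)"
    by (intro mult_left_mono nn_integral_mono) auto
  finally show "(\<integral>\<^sup>+x. f x \<partial>lborel) + (\<integral>\<^sup>+x. g x \<partial>lborel) \<le> 2 * (\<integral>\<^sup>+x. h x \<partial>lborel)" .
qed

lemma prekopa_leindler_real_bounded:
  fixes f g h :: "real \<Rightarrow> ennreal"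
  assumes [measurable]: "f \<in> borel_measurable borel" "g \<in> borel_measurable borel" "h \<in> borel_measurable borel"
    and le: "\<And>x y. f x * g y \<le> (h ((x + y) / 2))\<^sup>2"
    and bdd: "(SUP x. f x) < \<infinity>" "(SUP x. g x) < \<infinity>"
  shows "(\<integral>\<^sup>+x. f x \<partial>lborel) * (\<integral>\<^sup>+x. g x \<partial>lborel) \<le> (\<integral>\<^sup>+x. h x \<partial>lborel)\<^sup>2"
proof (cases "(SUP x. f x) = 0 \<or> (SUP x. g x) = 0")
  case True
  then have "(\<forall>x. f x = 0) \<or> (\<forall>x. g x = 0)"
    by (metis SUP_upper UNIV_I le_zero_eq)
  then show ?thesis by auto
next
  case False
  then obtain a b where a: "(SUP x. f x) = ennreal a" "a > 0" and b: "(SUP x. g x) = ennreal b" "b > 0"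
    using bdd by (cases "SUP x. f x"; cases "SUP x. g x") (auto simp: less_top[symmetric] order_less_le)
  \<comment> \<open>The geometric mean of the two suprema: dividing \<open>f\<close>,
    \<open>g\<close>, \<open>h\<close> by \<open>a\<close>, \<open>b\<close>, \<open>c\<close>
    preserves the hypothesis, because \<open>c\<^sup>2 = a * b\<close>.\<close>
  define c where "c = sqrt (a * b)"
  have c: "c > 0" "c * c = a * b" using a b by (auto simp: c_def)
  let ?i = "\<lambda>r. ennreal (1 / r)"
  have cancel: "ennreal r * (?i r * x) = x" if "r > 0" for r x
    using that by (simp add: mult.assoc[symmetric] ennreal_mult'[symmetric])
  have int: "(\<integral>\<^sup>+x. u x \<partial>lborel) = ennreal r * (\<integral>\<^sup>+x. ?i r * u x \<partial>lborel)"
    if [measurable]: "u \<in> borel_measurable borel" and "r > 0" for u :: "real \<Rightarrow> ennreal" and r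
    using cancel[OF that(2)] by (simp add: nn_integral_cmult[symmetric])
  have "(\<integral>\<^sup>+x. ?i a * f x \<partial>lborel) * (\<integral>\<^sup>+x. ?i b * g x \<partial>lborel) \<le> (\<integral>\<^sup>+x. ?i c * h x \<partial>lborel)\<^sup>2"
  proof (rule prekopa_leindler_real_normalized)
    show "(SUP x. ?i a * f x) = 1" "(SUP x. ?i b * g x) = 1"
      using a b by (simp_all add: SUP_mult_left_ennreal[symmetric] ennreal_mult'[symmetric])
    fix x y
    have "(?i a * f x) * (?i b * g y) = (?i a * ?i b) * (f x * g y)"
      by (simp add: mult_ac)
    also have "?i a * ?i b = (?i c)\<^sup>2"
      using a b c by (simp add: power2_eq_square ennreal_mult'[symmetric])
    also have "(?i c)\<^sup>2 * (f x * g y) \<le> (?i c)\<^sup>2 * (h ((x + y) / 2))\<^sup>2"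
      by (intro mult_left_mono le) simp
    finally show "(?i a * f x) * (?i b * g y) \<le> (?i c * h ((x + y) / 2))\<^sup>2"
      by (simp add: power_mult_distrib)
  qed measurable
  then have "(ennreal c)\<^sup>2 * ((\<integral>\<^sup>+x. ?i a * f x \<partial>lborel) * (\<integral>\<^sup>+x. ?i b * g x \<partial>lborel))
      \<le> (ennreal c)\<^sup>2 * (\<integral>\<^sup>+x. ?i c * h x \<partial>lborel)\<^sup>2"
    by (rule mult_left_mono) simp
  also have "(ennreal c)\<^sup>2 = ennreal a * ennreal b"
    using a b c by (simp add: power2_eq_square ennreal_mult'[symmetric])
  finally have "(ennreal a * (\<integral>\<^sup>+x. ?i a * f x \<partial>lborel)) * (ennreal b * (\<integral>\<^sup>+x. ?i b * g x \<partial>lborel))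
      \<le> (ennreal c * (\<integral>\<^sup>+x. ?i c * h x \<partial>lborel))\<^sup>2"
    using \<open>(ennreal c)\<^sup>2 = ennreal a * ennreal b\<close> by (simp only: power_mult_distrib mult_ac)
  then show ?thesis
    using int[of f a] int[of g b] int[of h c] a b c by simp
qed

text \<open>Truncating \<open>f\<close> and \<open>g\<close> at constants makes them bounded and
  preserves the hypothesis with the same \<open>h\<close>; monotone convergence removes the
  truncation.\<close>

lemma prekopa_leindler_real:
  fixes f g h :: "real \<Rightarrow> ennreal"
  assumes [measurable]: "f \<in> borel_measurable borel" "g \<in> borel_measurable borel" "h \<in> borel_measurable borel"
    and le: "\<And>x y. f x * g y \<le> (h ((x + y) / 2))\<^sup>2"
  shows "(\<integral>\<^sup>+x. f x \<partial>lborel) * (\<integral>\<^sup>+x. g x \<partial>lborel) \<le> (\<integral>\<^sup>+x. h x \<partial>lborel)\<^sup>2"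
proof -
  have trunc: "(\<integral>\<^sup>+x. u x \<partial>lborel) = (SUP k. \<integral>\<^sup>+x. min (of_nat k) (u x) \<partial>lborel)"
    if [measurable]: "u \<in> borel_measurable borel" for u :: "real \<Rightarrow> ennreal"
  proof -
    have "u x = (SUP k::nat. min (of_nat k) (u x))" for x
    proof (rule antisym)
      show "(SUP k::nat. min (of_nat k) (u x)) \<le> u x" by (rule SUP_least) simp
      show "u x \<le> (SUP k::nat. min (of_nat k) (u x))"
      proof (cases "u x = \<infinity>")
        case True
        have "(SUP k::nat. min (of_nat k) (u x)) = (SUP k::nat. of_nat k)"
          by (rule SUP_cong) (simp_all add: True)
        also have "\<dots> = top" by (rule ennreal_SUP_of_nat_eq_top)
        finally show ?thesis by (simp only: top_greatest)
      next
        case False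
        then obtain r where r: "u x = ennreal r" by (cases "u x") auto
        obtain n :: nat where "r \<le> real n" using real_arch_simple by blast
        then have "u x \<le> of_nat n" using r by (simp add: ennreal_of_nat_eq_real_of_nat ennreal_leI)
        then show ?thesis by (intro SUP_upper2[of n]) auto
      qed
    qed
    then have "(\<integral>\<^sup>+x. u x \<partial>lborel) = (\<integral>\<^sup>+x. (SUP k::nat. min (of_nat k) (u x)) \<partial>lborel)" by simp
    also have "\<dots> = (SUP k. \<integral>\<^sup>+x. min (of_nat k) (u x) \<partial>lborel)"
      by (rule nn_integral_monotone_convergence_SUP)
         (auto simp: incseq_def le_fun_def intro!: min.coboundedI1 of_nat_mono)
    finally show ?thesis .
  qed
  have bdd: "(SUP x. min (of_nat j) (u x)) < top" for u :: "real \<Rightarrow> ennreal" and j :: nat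
  proof -
    have "(SUP x. min (of_nat j) (u x)) \<le> of_nat j" by (rule SUP_least) simp
    then show ?thesis by (rule le_less_trans) (simp add: ennreal_of_nat_eq_real_of_nat)
  qed
  have "(\<integral>\<^sup>+x. min (of_nat j) (f x) \<partial>lborel) * (\<integral>\<^sup>+x. min (of_nat k) (g x) \<partial>lborel) \<le> (\<integral>\<^sup>+x. h x \<partial>lborel)\<^sup>2"
    for j k :: nat
  proof (rule prekopa_leindler_real_bounded)
    fix x y
    show "min (of_nat j) (f x) * min (of_nat k) (g y) \<le> (h ((x + y) / 2))\<^sup>2"
      by (rule order_trans[OF mult_mono le]) auto
  qed (auto simp: bdd)
  then show ?thesis
    unfolding trunc[OF assms(1)] trunc[OF assms(2)] SUP_mult_right_ennreal SUP_mult_left_ennreal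
    by (intro SUP_least) auto
qed

text \<open>Fixing the new coordinate at \<open>s\<close>, \<open>t\<close> and their midpoint gives
  sections that satisfy the hypothesis in one dimension less. The induction hypothesis then says
  that the integrals of the sections, as functions of the new coordinate, satisfy the hypothesis of
  the one-dimensional case.\<close>

theorem prekopa_leindler_PiM:
  fixes f g h :: "('i \<Rightarrow> real) \<Rightarrow> ennreal"
  assumes "finite I"
    and "f \<in> borel_measurable (PiM I (\<lambda>_. lborel))" "g \<in> borel_measurable (PiM I (\<lambda>_. lborel))"
      "h \<in> borel_measurable (PiM I (\<lambda>_. lborel))"
    and "\<And>x y. f x * g y \<le> (h (\<lambda>i\<in>I. (x i + y i) / 2))\<^sup>2"
  shows "(\<integral>\<^sup>+x. f x \<partial>PiM I (\<lambda>_. lborel)) * (\<integral>\<^sup>+x. g x \<partial>PiM I (\<lambda>_. lborel))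
    \<le> (\<integral>\<^sup>+x. h x \<partial>PiM I (\<lambda>_. lborel))\<^sup>2"
  using assms
proof (induction I arbitrary: f g h rule: finite_induct)
  case empty
  have "(\<lambda>i\<in>{}. (x i + y i) / 2) = (\<lambda>i. undefined)" for x y :: "'i \<Rightarrow> real" by (simp add: restrict_def)
  then show ?case using empty(4) by (simp add: lborel_product.nn_integral_empty)
next
  case (insert i J)
  let ?P = "\<lambda>I. PiM I (\<lambda>_. lborel :: real measure)"
  note m = insert.prems(1-3)
  have fm: "(\<lambda>(s, x). u (x(i := s))) \<in> borel_measurable (borel \<Otimes>\<^sub>M ?P J)"
    if "u \<in> borel_measurable (?P (insert i J))" for u :: "('i \<Rightarrow> real) \<Rightarrow> ennreal"
  proof -
    have "(\<lambda>(x, s). x(i := s)) \<in> measurable (?P J \<Otimes>\<^sub>M lborel) (?P (insert i J))"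
      by (rule measurable_add_dim)
    then have "(\<lambda>p. (\<lambda>(x, s). x(i := s)) (snd p, fst p)) \<in> measurable (borel \<Otimes>\<^sub>M ?P J) (?P (insert i J))"
      by (rule measurable_compose[rotated]) simp
    from measurable_compose[OF this that] show ?thesis by (simp add: case_prod_unfold)
  qed
  have sec: "(\<lambda>x. u (x(i := s))) \<in> borel_measurable (?P J)"
    if "u \<in> borel_measurable (?P (insert i J))" for u :: "('i \<Rightarrow> real) \<Rightarrow> ennreal" and s
    using measurable_compose[OF measurable_Pair1' fm[OF that], of s] by simp
  have int: "(\<lambda>s. \<integral>\<^sup>+x. u (x(i := s)) \<partial>?P J) \<in> borel_measurable borel"
    if "u \<in> borel_measurable (?P (insert i J))" for u :: "('i \<Rightarrow> real) \<Rightarrow> ennreal"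
  proof -
    interpret J: finite_product_sigma_finite "\<lambda>_. lborel :: real measure" J
      by standard (rule insert.hyps)
    show ?thesis using J.borel_measurable_nn_integral[OF fm[OF that]] .
  qed
  have "(\<integral>\<^sup>+s. \<integral>\<^sup>+x. f (x(i := s)) \<partial>?P J \<partial>lborel) * (\<integral>\<^sup>+s. \<integral>\<^sup>+x. g (x(i := s)) \<partial>?P J \<partial>lborel)
      \<le> (\<integral>\<^sup>+s. \<integral>\<^sup>+x. h (x(i := s)) \<partial>?P J \<partial>lborel)\<^sup>2"
  proof (rule prekopa_leindler_real)
    fix s t
    show "(\<integral>\<^sup>+x. f (x(i := s)) \<partial>?P J) * (\<integral>\<^sup>+x. g (x(i := t)) \<partial>?P J)
        \<le> (\<integral>\<^sup>+x. h (x(i := (s + t) / 2)) \<partial>?P J)\<^sup>2"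
    proof (rule insert.IH)
      fix x y :: "'i \<Rightarrow> real"
      have "(\<lambda>j\<in>insert i J. ((x(i := s)) j + (y(i := t)) j) / 2)
          = (\<lambda>j\<in>J. (x j + y j) / 2)(i := (s + t) / 2)"
        using insert.hyps by (auto simp: fun_eq_iff)
      then show "f (x(i := s)) * g (y(i := t)) \<le> (h ((\<lambda>j\<in>J. (x j + y j) / 2)(i := (s + t) / 2)))\<^sup>2"
        using insert.prems(4)[of "x(i := s)" "y(i := t)"] by (simp only:)
    qed (rule sec m)+
  qed (rule int m)+
  then show ?case
    using insert.hyps m by (simp add: lborel_product.product_nn_integral_insert_rev)
qed

section \<open>Lebesgue measure on a subspace\<close>

locale orthonormal_system =
  fixes Bas :: "'a::euclidean_space set"
  assumes finite_Bas: "finite Bas"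
    and inner_Bas: "\<And>b c. b \<in> Bas \<Longrightarrow> c \<in> Bas \<Longrightarrow> b \<bullet> c = (if b = c then 1 else 0)"
begin

definition combine :: "('a \<Rightarrow> real) \<Rightarrow> 'a" where
  "combine x = (\<Sum>b\<in>Bas. x b *\<^sub>R b)"

lemma combine_inner:
  assumes b: "b \<in> Bas"
  shows "combine x \<bullet> b = x b"
proof -
  have "combine x \<bullet> b = (\<Sum>c\<in>Bas. if c = b then x b else 0)"
    unfolding combine_def inner_sum_left using b by (intro sum.cong) (auto simp: inner_Bas)
  then show ?thesis using b finite_Bas by simp
qed

lemma combine_in_span: "combine x \<in> span Bas"
  unfolding combine_def by (intro span_sum span_scale span_base)

lemma combine_restrict: "combine (restrict x Bas) = combine x"
  unfolding combine_def by (intro sum.cong) auto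

lemma combine_of_inner:
  assumes "y \<in> span Bas"
  shows "combine (\<lambda>b. y \<bullet> b) = y"
  using assms
proof (induction rule: span_induct_alt)
  case (step c x y)
  have "combine (\<lambda>b. (c *\<^sub>R x + y) \<bullet> b) = c *\<^sub>R combine (\<lambda>b. x \<bullet> b) + combine (\<lambda>b. y \<bullet> b)"
    by (simp add: combine_def inner_add_left scaleR_add_left sum.distrib scaleR_sum_right)
  moreover have "combine (\<lambda>b. x \<bullet> b) = x"
  proof -
    have "combine (\<lambda>b. x \<bullet> b) = (\<Sum>b\<in>Bas. if x = b then b else 0)"
      unfolding combine_def using step by (intro sum.cong) (auto simp: inner_Bas)
    then show ?thesis using step finite_Bas by simp
  qed
  ultimately show ?case using step by simp
qed (simp add: combine_def)

lemma combine_add: "combine (\<lambda>b. x b + y b) = combine x + combine y"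
  by (simp add: combine_def scaleR_add_left sum.distrib)

lemma combine_scale: "combine (\<lambda>b. c * x b) = c *\<^sub>R combine x"
  by (simp add: combine_def scaleR_sum_right)

abbreviation coordinate_space :: "('a \<Rightarrow> real) measure" where
  "coordinate_space \<equiv> PiM Bas (\<lambda>_. lborel)"

lemma combine_measurable [measurable]: "combine \<in> borel_measurable coordinate_space"
  unfolding combine_def by measurable

text \<open>Lebesgue measure of the subspace \<open>span Bas\<close>, kept as a Borel measure on the
  ambient space so that it can be compared with a Hausdorff measure there without passing to a
  subtype.\<close>

definition span_measure :: "'a measure" where
  "span_measure = distr coordinate_space borel combine"

lemma sets_span_measure [simp, measurable_cong]: "sets span_measure = sets borel"
  and space_span_measure [simp]: "space span_measure = UNIV"
  by (simp_all add: span_measure_def)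

lemma closed_span_Bas [measurable]: "span Bas \<in> sets borel"
  by (simp add: closed_subspace borel_closed)

lemma AE_span_measure: "AE x in span_measure. x \<in> span Bas"
  unfolding span_measure_def by (subst AE_distr_iff) (auto simp: combine_in_span)

lemma emeasure_span_measure:
  "A \<in> sets borel \<Longrightarrow> emeasure span_measure A = (\<integral>\<^sup>+x. indicator A (combine x) \<partial>coordinate_space)"
proof -
  assume [measurable]: "A \<in> sets borel"
  have "emeasure span_measure A = (\<integral>\<^sup>+x. indicator A x \<partial>span_measure)" by simp
  also have "\<dots> = (\<integral>\<^sup>+x. indicator A (combine x) \<partial>coordinate_space)"
    unfolding span_measure_def by (rule nn_integral_distr) measurable
  finally show ?thesis .
qed

text \<open>The maps covered here are unipotent and upper triangular in the coordinates of \<open>Bas\<close>.\<close>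

lemma emeasure_span_measure_triangular:
  fixes rank :: "'a \<Rightarrow> nat"
  assumes rank: "\<And>x y b. b \<in> Bas \<Longrightarrow> x \<in> span Bas \<Longrightarrow> y \<in> span Bas \<Longrightarrow>
      (\<And>c. c \<in> Bas \<Longrightarrow> rank c < rank b \<Longrightarrow> x \<bullet> c = y \<bullet> c) \<Longrightarrow>
      (\<psi> x - x) \<bullet> b = (\<psi> y - y) \<bullet> b"
    and [measurable]: "\<psi> \<in> borel_measurable borel"
    and \<psi>: "\<And>x. x \<in> span Bas \<Longrightarrow> \<psi> x \<in> span Bas"
    and [measurable]: "A \<in> sets borel"
  shows "emeasure span_measure (\<psi> -` A) = emeasure span_measure A"
proof -
  have [measurable]: "\<psi> -` A \<in> sets borel"
    using measurable_sets[of \<psi> borel borel A] assms(2,4) by simp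
  define \<phi> where "\<phi> b x = (\<psi> (combine x) - combine x) \<bullet> b" for b x
  have "combine (\<lambda>b\<in>Bas. x b + \<phi> b x) = \<psi> (combine x)" for x
  proof -
    have "combine (\<lambda>b\<in>Bas. x b + \<phi> b x) = combine (\<lambda>b. \<psi> (combine x) \<bullet> b)"
      unfolding combine_restrict unfolding combine_def[of "\<lambda>b. x b + \<phi> b x"] combine_def[of "\<lambda>b. \<psi> (combine x) \<bullet> b"]
      by (intro sum.cong) (auto simp: \<phi>_def inner_diff_left combine_inner)
    then show ?thesis using combine_of_inner[OF \<psi>[OF combine_in_span]] by simp
  qed
  moreover have "(\<integral>\<^sup>+x. indicator A (combine (\<lambda>b\<in>Bas. x b + \<phi> b x)) \<partial>coordinate_space)
      = (\<integral>\<^sup>+x. indicator A (combine x) \<partial>coordinate_space)"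
  proof (rule nn_integral_PiM_triangular[OF finite_Bas, of \<phi> rank])
    show "\<phi> b \<in> borel_measurable coordinate_space" for b
      unfolding \<phi>_def by measurable
    show "\<phi> b x = \<phi> b y" if "b \<in> Bas" "\<And>c. c \<in> Bas \<Longrightarrow> rank c < rank b \<Longrightarrow> x c = y c" for b x y
      unfolding \<phi>_def by (rule rank) (use that in \<open>auto simp: combine_in_span combine_inner\<close>)
  qed measurable
  ultimately have "(\<integral>\<^sup>+x. indicator (\<psi> -` A) (combine x) \<partial>coordinate_space)
      = (\<integral>\<^sup>+x. indicator A (combine x) \<partial>coordinate_space)"
    by (simp add: indicator_vimage)
  then show ?thesis by (simp add: emeasure_span_measure)
qed

lemma emeasure_span_measure_translation:
  assumes "v \<in> span Bas" "A \<in> sets borel"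
  shows "emeasure span_measure ((+) v -` A) = emeasure span_measure A"
  using assms by (intro emeasure_span_measure_triangular[of "\<lambda>_. 0"]) (auto intro: span_add)

lemma coordinate_box:
  assumes "r \<ge> 0"
  shows "emeasure coordinate_space (\<Pi>\<^sub>E b\<in>Bas. {- r..r}) = ennreal ((2 * r) ^ card Bas)"
  using assms finite_Bas
  by (subst lborel_product.emeasure_PiM) (auto simp: prod_ennreal ennreal_power)

lemma emeasure_span_measure_bounded:
  assumes "A \<in> sets borel" "bounded A"
  shows "emeasure span_measure A < \<infinity>"
proof -
  obtain r where r: "r > 0" "\<And>x. x \<in> A \<Longrightarrow> norm x \<le> r"
    using assms(2) bounded_pos by blast
  have "emeasure span_measure A = emeasure coordinate_space (combine -` A \<inter> space coordinate_space)"
    unfolding span_measure_def using assms(1) by (intro emeasure_distr) auto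
  also have "\<dots> \<le> emeasure coordinate_space (\<Pi>\<^sub>E b\<in>Bas. {- r..r})"
  proof (rule emeasure_mono)
    show "combine -` A \<inter> space coordinate_space \<subseteq> (\<Pi>\<^sub>E b\<in>Bas. {- r..r})"
    proof
      fix x assume x: "x \<in> combine -` A \<inter> space coordinate_space"
      have "x b \<in> {- r..r}" if b: "b \<in> Bas" for b
      proof -
        have "norm b = 1" using inner_Bas[OF b b] by (simp add: norm_eq_1)
        then have "\<bar>x b\<bar> \<le> norm (combine x)"
          using Cauchy_Schwarz_ineq2[of "combine x" b] combine_inner[OF b, of x] by simp
        also have "\<dots> \<le> r" using r x by auto
        finally show ?thesis by (simp add: abs_le_iff)
      qed
      moreover have "x \<in> extensional Bas" using x by (simp add: space_PiM PiE_iff)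
      ultimately show "x \<in> (\<Pi>\<^sub>E b\<in>Bas. {- r..r})"
        by (simp only: PiE_iff) blast
    qed
    show "(\<Pi>\<^sub>E b\<in>Bas. {- r..r}) \<in> sets coordinate_space"
      using finite_Bas by (intro sets_PiM_I_finite) auto
  qed
  also have "\<dots> < \<infinity>" using r by (simp add: coordinate_box)
  finally show ?thesis .
qed

lemma emeasure_span_measure_pos:
  assumes A: "A \<in> sets borel" and "r > 0" and ball: "\<And>x. x \<in> span Bas \<Longrightarrow> norm x < r \<Longrightarrow> x \<in> A"
  shows "emeasure span_measure A > 0"
proof -
  \<comment> \<open>By the triangle inequality the coordinate box of half-side \<open>s\<close> lies
    in the ball of radius \<open>r\<close>. The summand \<open>1\<close> makes the inequality strict
    and covers an empty basis.\<close>
  define s where "s = r / (real (card Bas) + 1)"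
  have s: "s > 0" "real (card Bas) * s < r"
    using \<open>r > 0\<close> by (auto simp: s_def field_simps)
  have "0 < emeasure coordinate_space (\<Pi>\<^sub>E b\<in>Bas. {- s..s})"
    using s by (simp add: coordinate_box)
  also have "\<dots> \<le> emeasure coordinate_space (combine -` A \<inter> space coordinate_space)"
  proof (rule emeasure_mono)
    show "(\<Pi>\<^sub>E b\<in>Bas. {- s..s}) \<subseteq> combine -` A \<inter> space coordinate_space"
    proof
      fix x assume x: "x \<in> (\<Pi>\<^sub>E b\<in>Bas. {- s..s})"
      have "norm (combine x) \<le> (\<Sum>b\<in>Bas. norm (x b *\<^sub>R b))"
        unfolding combine_def by (rule norm_sum)
      also have "\<dots> \<le> (\<Sum>b\<in>Bas. s)"
      proof (rule sum_mono)
        fix b assume b: "b \<in> Bas"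
        then have "norm b = 1" using inner_Bas[OF b b] by (simp add: norm_eq_1)
        moreover have "x b \<in> {- s..s}" using x b by (rule PiE_mem)
        ultimately show "norm (x b *\<^sub>R b) \<le> s" by (auto simp: abs_le_iff)
      qed
      also have "\<dots> < r" using s by simp
      finally have "combine x \<in> A" by (intro ball combine_in_span)
      then show "x \<in> combine -` A \<inter> space coordinate_space"
        using x by (auto simp: space_PiM PiE_iff)
    qed
    show "combine -` A \<inter> space coordinate_space \<in> sets coordinate_space"
      using A by (rule measurable_sets[OF combine_measurable])
  qed
  also have "\<dots> = emeasure span_measure A"
    unfolding span_measure_def using A by (intro emeasure_distr[symmetric]) auto
  finally show ?thesis .
qed

lemma sigma_finite_span_measure: "sigma_finite_measure span_measure"
proof
  show "\<exists>A. countable A \<and> A \<subseteq> sets span_measure \<and> \<Union> A = space span_measure \<and>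
      (\<forall>a\<in>A. emeasure span_measure a \<noteq> \<infinity>)"
  proof (intro exI[of _ "range (\<lambda>k::nat. cball 0 (real k))"] conjI ballI)
    show "\<Union> (range (\<lambda>k::nat. cball 0 (real k))) = space span_measure"
      by (auto simp: real_arch_simple)
    fix a :: "'a set" assume "a \<in> range (\<lambda>k::nat. cball 0 (real k))"
    then show "emeasure span_measure a \<noteq> \<infinity>"
      using emeasure_span_measure_bounded[of a] by auto
  qed auto
qed

text \<open>The exchange identity with both measures equal to \<open>span_measure\<close>; the
  common factor, the measure of a ball, is positive and finite and cancels.\<close>

lemma emeasure_span_measure_uminus:
  assumes [measurable]: "A \<in> sets borel"
  shows "emeasure span_measure (uminus -` A) = emeasure span_measure A"
proof -
  let ?B = "cball 0 1 :: 'a set"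
  have "emeasure span_measure ?B * emeasure span_measure A
      = emeasure span_measure ?B * emeasure span_measure (uminus -` A)"
    by (rule invariant_measure_exchange[where N = "span Bas"])
       (auto simp: sigma_finite_span_measure AE_span_measure emeasure_span_measure_translation
          intro: span_neg)
  moreover have "emeasure span_measure ?B > 0"
    by (rule emeasure_span_measure_pos[of _ 1]) auto
  moreover have "emeasure span_measure ?B < \<infinity>"
    by (rule emeasure_span_measure_bounded) auto
  ultimately show ?thesis
    by (auto simp: ennreal_mult_cancel_left)
qed

text \<open>Prekopa--Leindler for indicator functions. \<open>C\<close> may be any Borel set
  containing the midpoints, so measurability of the set of midpoints is not at issue.\<close>

lemma brunn_minkowski_span_measure:
  assumes [measurable]: "A \<in> sets borel" "B \<in> sets borel" "C \<in> sets borel"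
    and mid: "\<And>x y. x \<in> A \<Longrightarrow> y \<in> B \<Longrightarrow> x \<in> span Bas \<Longrightarrow> y \<in> span Bas \<Longrightarrow> (1 / 2) *\<^sub>R (x + y) \<in> C"
  shows "emeasure span_measure A * emeasure span_measure B \<le> (emeasure span_measure C)\<^sup>2"
proof -
  have "combine (\<lambda>b\<in>Bas. (x b + y b) / 2) = (1 / 2) *\<^sub>R (combine x + combine y)" for x y
  proof -
    have "combine (\<lambda>b\<in>Bas. (x b + y b) / 2) = combine (\<lambda>b. (1 / 2) * (x b + y b))"
      unfolding combine_restrict by simp
    then show ?thesis by (simp only: combine_scale combine_add)
  qed
  then have "(indicator A (combine x) :: ennreal) * indicator B (combine y)
      \<le> (indicator C (combine (\<lambda>b\<in>Bas. (x b + y b) / 2)))\<^sup>2" for x y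
    using mid[OF _ _ combine_in_span combine_in_span] by (auto simp: indicator_def)
  then show ?thesis
    unfolding emeasure_span_measure[OF assms(1)] emeasure_span_measure[OF assms(2)]
      emeasure_span_measure[OF assms(3)]
    by (intro prekopa_leindler_PiM finite_Bas) measurable
qed

text \<open>The Hausdorff measure on the span is a multiple of \<open>span_measure\<close> by uniqueness of Haar
  measure; comparing two sets does not require the value of the constant.\<close>

lemma hausdorff_measure_le_of_span_measure_le:
  assumes E [measurable]: "E \<in> sets borel" "E \<subseteq> span Bas"
    and F [measurable]: "F \<in> sets borel" "F \<subseteq> span Bas" "bounded F"
    and sym: "\<And>x. x \<in> F \<Longrightarrow> - x \<in> F"
    and "r > 0" and ball: "\<And>x. x \<in> span Bas \<Longrightarrow> norm x < r \<Longrightarrow> x \<in> F"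
    and le: "emeasure span_measure E \<le> emeasure span_measure F"
  shows "hausdorff_measure n E \<le> hausdorff_measure n F"
\<comment> \<open>If \<open>F\<close> has infinite measure there is nothing to prove. Otherwise
  finiteness on \<open>F\<close> spreads to its multiples, which yields the sigma-finiteness that
  the exchange identity requires.\<close>
proof (cases "hausdorff_measure n F = \<infinity>")
  case False
  define M where "M = density (hausdorff_borel n) (indicator (span Bas))"
  have M [measurable_cong]: "sets M = sets borel" by (simp add: M_def)
  have eM: "emeasure M A = hausdorff_measure n (A \<inter> span Bas)" if [measurable]: "A \<in> sets borel" for A
  proof -
    have "emeasure M A = (\<integral>\<^sup>+x. indicator (span Bas) x * indicator A x \<partial>hausdorff_borel n)"
      unfolding M_def by (rule emeasure_density) auto
    also have "\<dots> = (\<integral>\<^sup>+x. indicator (A \<inter> span Bas) x \<partial>hausdorff_borel n)"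
      by (intro nn_integral_cong) (simp only: indicator_inter_arith mult.commute)
    also have "\<dots> = hausdorff_measure n (A \<inter> span Bas)"
      by (simp add: emeasure_hausdorff_borel)
    finally show ?thesis .
  qed
  have scaled: "hausdorff_measure n ((\<lambda>x. real k *\<^sub>R x) ` F) < \<infinity>" if "k > 0" for k :: nat
  proof -
    have "hausdorff_measure n ((\<lambda>x. real k *\<^sub>R x) ` F) \<le> ennreal (real k ^ n) * hausdorff_measure n F"
      using that by (intro hausdorff_measure_lipschitz) (auto simp: dist_norm scaleR_diff_right[symmetric])
    also have "\<dots> < \<infinity>" using False by (simp add: ennreal_mult_less_top top.not_eq_extremum)
    finally show ?thesis .
  qed
  have sf: "sigma_finite_measure M"
  proof
    \<comment> \<open>The multiples of \<open>F\<close> exhaust the span because \<open>F\<close>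
      contains a ball of it; the complement of the span is added to fill the space and is null for
      \<open>M\<close>.\<close>
    define A where "A k = (\<lambda>x. real (Suc k) *\<^sub>R x) ` F \<union> - span Bas" for k
    have mA: "(\<lambda>x. real (Suc k) *\<^sub>R x) ` F \<in> sets borel" for k
    proof -
      have "(\<lambda>x. real (Suc k) *\<^sub>R x) ` F = (\<lambda>x. (1 / real (Suc k)) *\<^sub>R x) -` F"
        by (auto intro!: image_eqI[where x = "(1 / real (Suc k)) *\<^sub>R _"] simp del: of_nat_Suc)
      moreover have "(\<lambda>x. (1 / real (Suc k)) *\<^sub>R x) -` F \<in> sets borel"
        using measurable_sets[of "\<lambda>x. (1 / real (Suc k)) *\<^sub>R x" borel borel F] F(1) by simp
      ultimately show ?thesis by simp
    qed
    show "\<exists>A. countable A \<and> A \<subseteq> sets M \<and> \<Union> A = space M \<and> (\<forall>a\<in>A. emeasure M a \<noteq> \<infinity>)"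
    proof (intro exI[of _ "range A"] conjI ballI)
      show "range A \<subseteq> sets M" using mA unfolding A_def M by auto
      have "\<exists>k. x \<in> A k" for x
      proof (cases "x \<in> span Bas")
        case True
        obtain k :: nat where "norm x / r < real k" using reals_Archimedean2 by blast
        then have k: "norm x < r * real (Suc k)" using \<open>r > 0\<close> by (simp add: field_simps)
        have "(1 / real (Suc k)) *\<^sub>R x \<in> F"
          using k True by (intro ball span_scale) (auto simp: field_simps)
        then have "real (Suc k) *\<^sub>R (1 / real (Suc k)) *\<^sub>R x \<in> (\<lambda>x. real (Suc k) *\<^sub>R x) ` F"
          by (rule imageI)
        then show ?thesis by (auto simp: A_def simp del: of_nat_Suc)
      qed (auto simp: A_def)
      then show "\<Union> (range A) = space M" by (auto simp: sets_eq_imp_space_eq[OF M])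
      fix a assume "a \<in> range A"
      then obtain k where k: "a = A k" by auto
      have "A k \<inter> span Bas \<subseteq> (\<lambda>x. real (Suc k) *\<^sub>R x) ` F" by (auto simp: A_def)
      then have "emeasure M (A k) \<le> hausdorff_measure n ((\<lambda>x. real (Suc k) *\<^sub>R x) ` F)"
        using mA by (subst eM) (auto simp: A_def intro: hausdorff_measure_mono)
      also have "\<dots> < \<infinity>" by (rule scaled) simp
      finally show "emeasure M a \<noteq> \<infinity>" using k by simp
    qed simp
  qed
  \<comment> \<open>Applied to \<open>v\<close> and to \<open>- v\<close>, this inequality becomes
    an equality.\<close>
  have iso: "hausdorff_measure n ((+) v ` A) \<le> hausdorff_measure n A" for v :: 'a and A
    using hausdorff_measure_lipschitz[of 1 "(+) v" n A] by simp
  have inv: "emeasure M ((+) v -` A) = emeasure M A" if v: "v \<in> span Bas" and A: "A \<in> sets borel" for v A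
  proof -
    have "(+) v -` A \<in> sets borel" using measurable_sets[of "(+) v" borel borel A] A by simp
    moreover have "(+) v -` A \<inter> span Bas = (+) (- v) ` (A \<inter> span Bas)"
    proof (safe intro!: imageI)
      fix x assume "v + x \<in> A" "x \<in> span Bas"
      then show "x \<in> (+) (- v) ` (A \<inter> span Bas)"
        using v by (intro image_eqI[of _ _ "v + x"]) (auto intro: span_add)
    next
      fix x assume "x \<in> span Bas"
      then show "- v + x \<in> span Bas" using v span_add span_neg by blast
    qed auto
    moreover have "A \<inter> span Bas = (+) v ` (+) (- v) ` (A \<inter> span Bas)"
      by (auto simp: image_image)
    ultimately show ?thesis
      using iso[of "- v" "A \<inter> span Bas"] iso[of v "(+) (- v) ` (A \<inter> span Bas)"] A
      by (simp add: eM)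
  qed
  have "emeasure M E * emeasure span_measure F = emeasure span_measure E * emeasure M (uminus -` F)"
  proof (rule invariant_measure_exchange[where N = "span Bas"])
    show "AE x in M. x \<in> span Bas"
      unfolding M_def by (subst AE_density) (auto simp: indicator_def)
  qed (auto simp: M sf inv sigma_finite_span_measure AE_span_measure emeasure_span_measure_translation
        intro: span_neg)
  also have "uminus -` F = F" using sym by force
  also have "emeasure span_measure E * emeasure M F \<le> emeasure M F * emeasure span_measure F"
    using le by (simp add: mult.commute mult_left_mono)
  finally have "emeasure span_measure F * emeasure M E \<le> emeasure span_measure F * emeasure M F"
    by (simp add: mult.commute)
  moreover have "emeasure span_measure F > 0"
    using F(1) \<open>r > 0\<close> ball by (rule emeasure_span_measure_pos)
  moreover have "emeasure span_measure F < \<infinity>"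
    using F by (intro emeasure_span_measure_bounded)
  ultimately have "emeasure M E \<le> emeasure M F"
    by (simp add: ennreal_mult_le_mult_iff)
  then show ?thesis using E F by (simp add: eM Int_absorb2)
qed simp

end

section \<open>The group law\<close>

text \<open>Separates the pattern of a word, a list of Booleans, from the letters put into it: an
  induction over one fixed pattern can then compare two choices of letters.\<close>

lemma bch_word_map: "bch_word x y p = map (\<lambda>b. if b then y else x) (bch_word False True p)"
  by (simp add: bch_word_def map_concat case_prod_unfold comp_def)

lemma length_bch_word: "length (bch_word x y p) = (\<Sum>(r, s) \<leftarrow> p. r + s)"
  by (simp add: bch_word_def length_concat case_prod_unfold comp_def)

lemma bch_index_length_one:
  assumes "p \<in> bch_index \<iota>" "length (bch_word x y p) = 1"
  shows "p = [(1, 0)] \<or> p = [(0, 1)]"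
proof -
  have pos: "p \<noteq> []" "\<forall>(r, s) \<in> set p. r + s > 0" and sum: "(\<Sum>(r, s) \<leftarrow> p. r + s) = 1"
    using assms by (auto simp: bch_index_def length_bch_word)
  obtain r s q where p: "p = (r, s) # q" using pos(1) by (cases p) auto
  have rs: "r + s = 1" "(\<Sum>(r, s) \<leftarrow> q. r + s) = 0"
  proof -
    have "r + s > 0" using pos(2) p by simp
    moreover have "(r + s) + (\<Sum>(r, s) \<leftarrow> q. r + s) = 1" using sum p by simp
    ultimately show "r + s = 1" "(\<Sum>(r, s) \<leftarrow> q. r + s) = 0" by linarith+
  qed
  have "q = []"
  proof (cases q)
    case (Cons t q')
    then obtain a b where "q = (a, b) # q'" by (cases t) auto
    then show ?thesis using rs(2) pos(2) p by auto
  qed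
  then show ?thesis using rs(1) p by (auto simp: add_is_1)
qed

text \<open>The indices whose words contain a genuine bracket. The letters \<open>False\<close> and
  \<open>True\<close> are placeholders, since the length depends only on \<open>p\<close>.\<close>

definition bch_higher :: "nat \<Rightarrow> (nat \<times> nat) list set" where
  "bch_higher \<iota> = {p \<in> bch_index \<iota>. length (bch_word False True p) \<ge> 2}"

lemma bch_eq_add_higher:
  assumes "\<iota> \<ge> 1"
  shows "bch \<iota> br x y = x + y + (\<Sum>p\<in>bch_higher \<iota>. bch_coeff p *\<^sub>R lie_word br (bch_word x y p))"
proof -
  let ?f = "\<lambda>p. bch_coeff p *\<^sub>R lie_word br (bch_word x y p)"
  have "bch_index \<iota> = {[(1, 0)], [(0, 1)]} \<union> bch_higher \<iota>"
  proof
    show "bch_index \<iota> \<subseteq> {[(1, 0)], [(0, 1)]} \<union> bch_higher \<iota>"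
    proof
      fix p assume p: "p \<in> bch_index \<iota>"
      have "length (bch_word False True p) \<noteq> 0"
      proof -
        obtain a b q where "p = (a, b) # q" "a + b > 0"
          using p by (cases p) (auto simp: bch_index_def)
        then show ?thesis by (auto simp: length_bch_word)
      qed
      then have "length (bch_word False True p) = 1 \<or> length (bch_word False True p) \<ge> 2" by linarith
      then show "p \<in> {[(1, 0)], [(0, 1)]} \<union> bch_higher \<iota>"
        using bch_index_length_one[OF p] p by (auto simp: bch_higher_def)
    qed
    show "{[(1, 0)], [(0, 1)]} \<union> bch_higher \<iota> \<subseteq> bch_index \<iota>"
      using assms by (auto simp: bch_higher_def bch_index_def)
  qed
  moreover have "{[(1, 0)], [(0, 1)]} \<inter> bch_higher \<iota> = {}"
    by (auto simp: bch_higher_def length_bch_word)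
  moreover have "finite (bch_higher \<iota>)"
    unfolding bch_higher_def using finite_bch_index by simp
  ultimately have "bch \<iota> br x y = (\<Sum>p\<in>{[(1, 0)], [(0, 1)]}. ?f p) + (\<Sum>p\<in>bch_higher \<iota>. ?f p)"
    unfolding bch_def by (simp only:) (rule sum.union_disjoint, auto)
  also have "(\<Sum>p\<in>{[(1, 0)], [(0, 1)]}. ?f p) = x + y"
    by (simp add: bch_coeff_def bch_word_def)
  finally show ?thesis .
qed

section \<open>The descending filtration and left translations\<close>

context homogeneous_group
begin

lemma bounded_bilinear_bracket: "bounded_bilinear br"
  using bilinear_bracket bilinear_conv_bounded_bilinear by blast

text \<open>The filtration by sums of the layers of degree at least \<open>k\<close>. Indices beyond
  \<open>\<iota>\<close> contribute only \<open>0\<close>; including them avoids case distinctions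
  when degrees add up past the top layer.\<close>

definition tail :: "nat \<Rightarrow> 'a set" where
  "tail k = span (\<Union>i\<in>{k..}. H i)"

lemma subspace_tail: "subspace (tail k)"
  by (simp add: tail_def)

lemma tail_mono: "k \<le> l \<Longrightarrow> tail l \<subseteq> tail k"
  unfolding tail_def by (intro span_mono UN_mono) auto

lemma tail_1: "tail 1 = UNIV"
proof -
  have "span (\<Union>i\<in>{1..\<iota>}. H i) \<subseteq> tail 1"
    unfolding tail_def by (intro span_mono) auto
  then show ?thesis using span_layers by auto
qed

lemma layer_subset_tail: "k \<le> i \<Longrightarrow> H i \<subseteq> tail k"
  unfolding tail_def by (auto intro!: span_base)

lemma bracket_tail:
  assumes "x \<in> tail i" "y \<in> tail j" "i \<ge> 1" "j \<ge> 1"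
  shows "br x y \<in> tail (i + j)"
  unfolding tail_def
proof (rule bracket_in_span[OF assms(1,2)[unfolded tail_def]])
  fix a b assume "a \<in> (\<Union>i\<in>{i..}. H i)" "b \<in> (\<Union>i\<in>{j..}. H i)"
  then obtain k l where kl: "k \<ge> i" "a \<in> H k" "l \<ge> j" "b \<in> H l" by auto
  then have "br a b \<in> H (k + l)" using assms(3,4) by (intro bracket_layers) auto
  then show "br a b \<in> span (\<Union>i\<in>{i + j..}. H i)"
    using kl by (intro span_base UN_I[of "k + l"]) auto
qed

lemma orthogonal_tail_layer:
  assumes k: "k \<in> {1..\<iota>}" and x: "x \<in> tail (k + 1)" and y: "y \<in> H k"
  shows "x \<bullet> y = 0"
proof -
  have "(\<Union>i\<in>{k + 1..}. H i) \<subseteq> {x. x \<bullet> y = 0}"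
  proof
    fix z assume "z \<in> (\<Union>i\<in>{k + 1..}. H i)"
    then obtain i where i: "i \<ge> k + 1" "z \<in> H i" by auto
    show "z \<in> {x. x \<bullet> y = 0}"
    proof (cases "i \<le> \<iota>")
      case True
      then show ?thesis using orthogonal_layers[of i k z y] i y k by auto
    next
      case False
      then show ?thesis using layer_above[of i] i by auto
    qed
  qed
  moreover have "subspace {x. x \<bullet> y = 0}"
    by (simp add: subspace_def inner_add_left)
  ultimately have "tail (k + 1) \<subseteq> {x. x \<bullet> y = 0}"
    unfolding tail_def by (rule span_minimal)
  then show ?thesis using x by auto
qed

lemma lie_word_Cons: "w \<noteq> [] \<Longrightarrow> lie_word br (z # w) = br z (lie_word br w)"
  by (cases w) auto

text \<open>A telescoping difference: each term has one factor changed by an element of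
  \<open>tail k\<close>, and bracketing with any element of \<open>tail 1\<close>, the whole space,
  raises the degree by one. A single letter gains nothing, hence the two-part conclusion that the
  induction carries.\<close>

lemma lie_word_diff_in_tail:
  assumes k: "k \<ge> 1" and fg: "\<And>b. f b - g b \<in> tail k" and "w \<noteq> []"
  shows "lie_word br (map f w) - lie_word br (map g w) \<in> tail k \<and>
    (length w \<ge> 2 \<longrightarrow> lie_word br (map f w) - lie_word br (map g w) \<in> tail (k + 1))"
  using \<open>w \<noteq> []\<close>
proof (induction w rule: list_nonempty_induct)
  case (single b)
  then show ?case using fg by simp
next
  case (cons b w)
  interpret br: bounded_bilinear br by (rule bounded_bilinear_bracket)
  let ?F = "lie_word br (map f w)" and ?G = "lie_word br (map g w)"
  have "br (f b) ?F - br (g b) ?G = br (f b - g b) ?F + br (g b) (?F - ?G)"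
    by (simp add: br.diff_left br.diff_right)
  moreover have "br (f b - g b) ?F \<in> tail (k + 1)"
    using tail_1 k by (intro bracket_tail fg) auto
  moreover have "br (g b) (?F - ?G) \<in> tail (1 + k)"
    using tail_1 k cons.IH by (intro bracket_tail) auto
  ultimately have "br (f b) ?F - br (g b) ?G \<in> tail (k + 1)"
    using subspace_add[OF subspace_tail] by (simp add: add.commute)
  then show ?case
    using cons.hyps tail_mono[of k "k + 1"] by (auto simp: lie_word_Cons)
qed

text \<open>To leading order in the filtration, a left translation acts on differences as the
  identity. This one fact gives both the invariance of \<open>N\<close> under the change of
  variables and its triangular shape.\<close>

lemma bch_diff_in_tail:
  assumes k: "k \<ge> 1" and y: "y - z \<in> tail k"
  shows "bch \<iota> br u y - bch \<iota> br u z - (y - z) \<in> tail (k + 1)"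
proof -
  let ?D = "\<lambda>p. bch_coeff p *\<^sub>R lie_word br (bch_word u y p) - bch_coeff p *\<^sub>R lie_word br (bch_word u z p)"
  have "bch \<iota> br u y - bch \<iota> br u z - (y - z) = (\<Sum>p\<in>bch_higher \<iota>. ?D p)"
    by (simp add: bch_eq_add_higher[OF step_pos] sum_subtractf)
  also have "\<dots> \<in> tail (k + 1)"
  proof (rule subspace_sum[OF subspace_tail])
    fix p assume "p \<in> bch_higher \<iota>"
    then have p: "length (bch_word False True p) \<ge> 2" by (simp add: bch_higher_def)
    then have "bch_word False True p \<noteq> []" by auto
    then have "lie_word br (bch_word u y p) - lie_word br (bch_word u z p) \<in> tail (k + 1)"
      using lie_word_diff_in_tail[OF k, of "\<lambda>b. if b then y else u" "\<lambda>b. if b then z else u"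
          "bch_word False True p"] p y subspace_0[OF subspace_tail]
      by (simp add: bch_word_map[of u])
    then show "?D p \<in> tail (k + 1)"
      by (simp add: scaleR_diff_right[symmetric] subspace_scale[OF subspace_tail])
  qed
  finally show ?thesis .
qed

text \<open>The innermost bracket has two multiples of \<open>x\<close> as its arguments and
  vanishes; the outer brackets preserve \<open>0\<close>.\<close>

lemma lie_word_multiples:
  assumes "length w \<ge> 2"
  shows "lie_word br (map (\<lambda>b. c b *\<^sub>R x) w) = 0"
  using assms
proof (induction w)
  case (Cons b w)
  interpret br: bounded_bilinear br by (rule bounded_bilinear_bracket)
  show ?case
  proof (cases "length w \<ge> 2")
    case True
    then show ?thesis using Cons.IH by (cases w) (auto simp: br.zero_right)
  next
    case False
    then have "length w = Suc 0" using Cons.prems by auto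
    then obtain b' where "w = [b']" by (auto simp: length_Suc_conv)
    then show ?thesis by (simp add: br.scaleR_left br.scaleR_right bracket_self)
  qed
qed simp

text \<open>On a line through \<open>0\<close> only the linear terms of the series survive. The unit
  \<open>0\<close> and the inverse \<open>- x\<close> are read off from here.\<close>

lemma bch_multiples: "bch \<iota> br (a *\<^sub>R x) (b *\<^sub>R x) = (a + b) *\<^sub>R x"
proof -
  have "lie_word br (bch_word (a *\<^sub>R x) (b *\<^sub>R x) p) = 0" if "p \<in> bch_higher \<iota>" for p
  proof -
    have "bch_word (a *\<^sub>R x) (b *\<^sub>R x) p = map (\<lambda>t. (if t then b else a) *\<^sub>R x) (bch_word False True p)"
      unfolding bch_word_map[of "a *\<^sub>R x"] by (rule map_cong) auto
    then show ?thesis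
      using that lie_word_multiples[of "bch_word False True p" "\<lambda>t. if t then b else a" x]
      by (simp only:) (simp add: bch_higher_def)
  qed
  then show ?thesis by (simp add: bch_eq_add_higher[OF step_pos] scaleR_add_left)
qed

lemma bch_zero_right: "bch \<iota> br x 0 = x"
  using bch_multiples[of 1 x 0] by simp

lemma bch_minus_right: "bch \<iota> br x (- x) = 0"
  using bch_multiples[of 1 x "- 1"] by simp

lemma continuous_on_bch: "continuous_on UNIV (bch \<iota> br u)"
proof -
  have "continuous_on UNIV (\<lambda>y. lie_word br (map (\<lambda>b. if b then y else u) w))" for w
  proof (induction w)
    case (Cons b w)
    show ?case
    proof (cases "w = []")
      case True
      then show ?thesis by (cases b) auto
    next
      case False
      have "continuous_on UNIV (\<lambda>y. if b then y else u)" by (cases b) auto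
      then have "continuous_on UNIV (\<lambda>y. br (if b then y else u) (lie_word br (map (\<lambda>b. if b then y else u) w)))"
        using Cons.IH by (rule bounded_bilinear.continuous_on[OF bounded_bilinear_bracket])
      then show ?thesis using False by (simp add: lie_word_Cons)
    qed
  qed simp
  then have "continuous_on UNIV (\<lambda>y. lie_word br (bch_word u y p))" for p
    by (simp add: bch_word_map[of u])
  then show ?thesis
    unfolding bch_def by (intro continuous_on_sum continuous_on_scaleR continuous_on_const)
qed

end

section \<open>Dilations and bases adapted to the layers\<close>

context homogeneous_group
begin

lemma dilation_inverse:
  assumes "r > 0"
  shows "dilation H \<iota> (1 / r) (dilation H \<iota> r x) = x"
proof -
  have lin: "linear (dilation H \<iota> s)" for s
    using dilation_properties by blast
  have layer: "dilation H \<iota> s y = s ^ i *\<^sub>R y" if "i \<in> {1..\<iota>}" "y \<in> H i" for s i y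
    using dilation_properties that by blast
  have "dilation H \<iota> (1 / r) \<circ> dilation H \<iota> r = id"
  proof (rule dilation_unique[where r = 1])
    show "linear (dilation H \<iota> (1 / r) \<circ> dilation H \<iota> r)"
      by (rule linear_compose) (rule lin)+
    fix i y assume iy: "i \<in> {1..\<iota>}" "y \<in> H i"
    show "(dilation H \<iota> (1 / r) \<circ> dilation H \<iota> r) y = 1 ^ i *\<^sub>R y"
      using assms by (simp add: layer[OF iy] linear_scale[OF lin] power_mult_distrib[symmetric])
  qed (auto simp: linear_id)
  then show ?thesis by (metis comp_apply id_apply)
qed

text \<open>Orthonormal bases of the pieces are joined, which stays orthonormal because different
  layers are orthogonal. Each basis vector lies in a single layer, and its degree \<open>rk\<close>
  serves as the rank for which left translations are triangular.\<close>

lemma adapted_basis_exists: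
  assumes S: "\<And>j. j \<in> J \<Longrightarrow> subspace (S j) \<and> S j \<subseteq> H j" and J: "J \<subseteq> {1..\<iota>}"
  obtains Bas rk where "orthonormal_system Bas" "span Bas = span (\<Union>j\<in>J. S j)"
    "\<And>b. b \<in> Bas \<Longrightarrow> rk b \<in> {1..\<iota>} \<and> b \<in> H (rk b)"
proof -
  have "\<exists>B. B \<subseteq> S j \<and> pairwise orthogonal B \<and> (\<forall>b\<in>B. norm b = 1) \<and> finite B \<and> span B = S j"
    if j: "j \<in> J" for j
  proof -
    obtain B where B: "B \<subseteq> S j" "pairwise orthogonal B" "\<And>x. x \<in> B \<Longrightarrow> norm x = 1"
      "independent B" "card B = dim (S j)" "span B = S j"
      using orthonormal_basis_subspace S[OF j] by metis
    then show ?thesis using independent_imp_finite by blast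
  qed
  then obtain B where B: "\<And>j. j \<in> J \<Longrightarrow> B j \<subseteq> S j \<and> pairwise orthogonal (B j) \<and>
      (\<forall>b\<in>B j. norm b = 1) \<and> finite (B j) \<and> span (B j) = S j"
    by metis
  define Bas where "Bas = (\<Union>j\<in>J. B j)"
  define rk where "rk b = (SOME j. j \<in> J \<and> b \<in> B j)" for b
  have rk: "rk b \<in> J \<and> b \<in> B (rk b)" if "b \<in> Bas" for b
    unfolding rk_def by (rule someI_ex) (use that in \<open>auto simp: Bas_def\<close>)
  show ?thesis
  proof
    show "orthonormal_system Bas"
    proof
      show "finite Bas" unfolding Bas_def using J B by (auto intro: finite_subset)
      fix b c assume bc: "b \<in> Bas" "c \<in> Bas"
      show "b \<bullet> c = (if b = c then 1 else 0)"
      proof (cases "b = c")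
        case True
        then have "norm b = 1" using rk[OF bc(1)] B by blast
        then show ?thesis using True by (simp add: norm_eq_1)
      next
        case False
        show ?thesis
        proof (cases "rk b = rk c")
          case True
          then have "b \<in> B (rk b)" "c \<in> B (rk b)" "pairwise orthogonal (B (rk b))"
            using rk[OF bc(1)] rk[OF bc(2)] B by auto
          then show ?thesis using False by (simp add: pairwise_def orthogonal_def)
        next
          case False
          have "b \<in> H (rk b)" "c \<in> H (rk c)" "rk b \<in> {1..\<iota>}" "rk c \<in> {1..\<iota>}"
            using rk[OF bc(1)] rk[OF bc(2)] B S J by blast+
          then show ?thesis using orthogonal_layers[of "rk b" "rk c" b c] False \<open>b \<noteq> c\<close> by simp
        qed
      qed
    qed
    show "span Bas = span (\<Union>j\<in>J. S j)"
    proof (rule subset_antisym)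
      show "span Bas \<subseteq> span (\<Union>j\<in>J. S j)"
        unfolding Bas_def using B by (intro span_mono UN_mono) auto
      have "S j \<subseteq> span Bas" if "j \<in> J" for j
        using B[OF that] span_mono[of "B j" Bas] that by (auto simp: Bas_def)
      then show "span (\<Union>j\<in>J. S j) \<subseteq> span Bas"
        by (intro span_minimal) auto
    qed
    show "rk b \<in> {1..\<iota>} \<and> b \<in> H (rk b)" if "b \<in> Bas" for b
      using rk[OF that] B S J by blast
  qed
qed

end

section \<open>Homogeneous distances\<close>

context homogeneous_distance
begin

lemma in_closed_ball: "y \<in> closed_ball d u r \<longleftrightarrow> d u y \<le> r"
  by (simp add: mcball_def)

lemma d_bch: "d u (bch \<iota> br u y) = d 0 y"
  using left_invariant[of u 0 y] by (simp add: bch_zero_right)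

lemma d_eq_d_zero: "d u y = d 0 (bch \<iota> br (- u) y)"
  using left_invariant[of "- u" u y] bch_minus_right[of "- u"] by simp

lemma d_zero_uminus: "d 0 (- x) = d 0 x"
  using d_bch[of x "- x"] by (simp add: bch_minus_right commute)

lemma linear_dilation: "linear (dilation H \<iota> r)"
  using dilation_properties by blast

lemma d_dilation: "r > 0 \<Longrightarrow> d 0 (dilation H \<iota> r x) = r * d 0 x"
  using dilation_homogeneous[of r 0 x] by (simp add: linear_0[OF linear_dilation])

end

section \<open>Euclidean topology of a convex homogeneous ball\<close>

locale convex_homogeneous_distance = homogeneous_distance +
  assumes convex_ball: "convex (closed_ball d 0 1)"
begin

text \<open>On a single layer a dilation is a scalar multiplication, so a multiple of each layer
  vector lies in the ball, and the ball spans the space. A convex set containing \<open>0\<close>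
  that spans has an interior point, and symmetry moves it to \<open>0\<close>.\<close>

lemma unit_ball_neighbourhood:
  obtains e where "e > 0" "ball 0 e \<subseteq> closed_ball d 0 1"
proof -
  let ?B = "closed_ball d 0 1"
  have 0: "0 \<in> ?B" by (simp add: in_closed_ball)
  have "H i \<subseteq> span ?B" if i: "i \<in> {1..\<iota>}" for i
  proof
    fix x assume x: "x \<in> H i"
    \<comment> \<open>The summand \<open>1\<close> keeps the factor defined at \<open>x = 0\<close>
      and still ensures \<open>r * d 0 x \<le> 1\<close>.\<close>
    define r where "r = 1 / (1 + d 0 x)"
    have pos: "1 + d 0 x > 0" using nonneg[of 0 x] by linarith
    then have r: "r > 0" "r * d 0 x \<le> 1" by (auto simp: r_def field_simps)
    have "dilation H \<iota> r x = r ^ i *\<^sub>R x"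
      using dilation_properties[of r] i x by blast
    then have "r ^ i *\<^sub>R x \<in> ?B"
      using d_dilation[OF r(1), of x] r(2) by (simp add: in_closed_ball)
    then have "(1 / r ^ i) *\<^sub>R r ^ i *\<^sub>R x \<in> span ?B"
      by (intro span_scale span_base)
    then show "x \<in> span ?B" using r(1) by simp
  qed
  then have "(\<Union>i\<in>{1..\<iota>}. H i) \<subseteq> span ?B"
    by (rule UN_least)
  then have "span (\<Union>i\<in>{1..\<iota>}. H i) \<subseteq> span ?B"
    by (rule span_minimal) simp
  then have "affine hull ?B = UNIV"
    using span_layers affine_hull_span_0[of ?B] hull_inc[OF 0] by auto
  then have "interior ?B \<noteq> {}"
    using rel_interior_interior[of ?B] rel_interior_eq_empty[OF convex_ball] 0 by auto
  then obtain z e where e: "e > 0" "ball z e \<subseteq> ?B"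
    by (auto simp: mem_interior)
  \<comment> \<open>Every \<open>y\<close> is the midpoint of \<open>z + 2 *\<^sub>R y\<close> and
    \<open>- z\<close>; halving the radius compensates for the factor \<open>2\<close>.\<close>
  have "ball 0 (e / 2) \<subseteq> ?B"
  proof
    fix y :: 'a assume "y \<in> ball 0 (e / 2)"
    then have "z + 2 *\<^sub>R y \<in> ball z e" by (simp add: dist_norm)
    then have 1: "z + 2 *\<^sub>R y \<in> ?B" using e by blast
    have "z \<in> ball z e" using e by simp
    then have "z \<in> ?B" using e by blast
    then have 2: "- z \<in> ?B" by (simp add: in_closed_ball d_zero_uminus)
    have "(1 / 2) *\<^sub>R (z + 2 *\<^sub>R y) + (1 / 2) *\<^sub>R (- z) \<in> ?B"
      by (rule convexD[OF convex_ball 1 2]) auto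
    then show "y \<in> ?B" by (simp add: scaleR_add_right)
  qed
  then show ?thesis using that[of "e / 2"] e by simp
qed

lemma d_zero_small:
  assumes "r > 0"
  shows "\<forall>\<^sub>F z in nhds 0. d 0 z \<le> r"
proof -
  obtain e where e: "e > 0" "ball 0 e \<subseteq> closed_ball d 0 1" by (rule unit_ball_neighbourhood)
  have "((dilation H \<iota> (1 / r)) \<longlongrightarrow> dilation H \<iota> (1 / r) 0) (nhds 0)"
    using linear_continuous_on[OF linear_conv_bounded_linear[THEN iffD1, OF linear_dilation], of UNIV "1 / r"]
    by (simp add: continuous_on_eq_continuous_at isCont_def tendsto_at_iff_tendsto_nhds)
  then have "\<forall>\<^sub>F z in nhds 0. dist (dilation H \<iota> (1 / r) z) 0 < e"
    using e(1) by (auto simp: tendsto_iff linear_0[OF linear_dilation])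
  then show ?thesis
  proof eventually_elim
    case (elim z)
    then have "dilation H \<iota> (1 / r) z \<in> closed_ball d 0 1"
      using e(2) by (auto simp: dist_commute)
    then have "(1 / r) * d 0 z \<le> 1"
      using d_dilation[of "1 / r" z] assms by (simp add: in_closed_ball)
    then show ?case using assms by (simp add: field_simps)
  qed
qed

text \<open>The triangle inequality bounds the variation of \<open>d 0\<close> near \<open>x\<close>
  by \<open>d x y = d 0 (bch \<iota> br (- x) y)\<close>, which reduces continuity at
  \<open>x\<close> to continuity at \<open>0\<close> and continuity of the group law.\<close>

lemma continuous_on_d_zero: "continuous_on UNIV (d 0)"
proof -
  have "((d 0) \<longlongrightarrow> d 0 x) (nhds x)" for x
  proof (rule tendstoI)
    fix e :: real assume "e > 0"
    have "((bch \<iota> br (- x)) \<longlongrightarrow> bch \<iota> br (- x) x) (nhds x)"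
      using continuous_on_bch[of "- x"]
      by (simp add: continuous_on_eq_continuous_at isCont_def tendsto_at_iff_tendsto_nhds)
    then have "filterlim (bch \<iota> br (- x)) (nhds 0) (nhds x)"
      using bch_minus_right[of "- x"] by simp
    moreover have "\<forall>\<^sub>F z in nhds 0. d 0 z \<le> e / 2"
      using \<open>e > 0\<close> by (intro d_zero_small) simp
    ultimately have "\<forall>\<^sub>F y in nhds x. d 0 (bch \<iota> br (- x) y) \<le> e / 2"
      by (rule eventually_compose_filterlim[rotated])
    then show "\<forall>\<^sub>F y in nhds x. dist (d 0 y) (d 0 x) < e"
    proof eventually_elim
      case (elim y)
      then have "d x y \<le> e / 2" by (simp add: d_eq_d_zero[of x])
      then show ?case
        using triangle[of 0 x y] triangle[of 0 y x] commute[of x y] \<open>e > 0\<close>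
        by (simp add: dist_real_def)
    qed
  qed
  then show ?thesis
    by (simp add: continuous_on_eq_continuous_at isCont_def tendsto_at_iff_tendsto_nhds)
qed

lemma closed_closed_ball: "closed (closed_ball d u r)"
proof -
  have "continuous_on UNIV (\<lambda>y. d 0 (bch \<iota> br (- u) y))"
    by (rule continuous_on_compose2[OF continuous_on_d_zero continuous_on_bch]) simp
  then have "closed {y. d 0 (bch \<iota> br (- u) y) \<le> r}"
    by (intro closed_Collect_le) auto
  moreover have "closed_ball d u r = {y. d 0 (bch \<iota> br (- u) y) \<le> r}"
    using in_closed_ball d_eq_d_zero[of u] by auto
  ultimately show ?thesis by simp
qed

text \<open>A dilate of the unit ball misses the Euclidean unit sphere and is star-shaped, hence it lies
  inside the Euclidean unit ball.\<close>

lemma bounded_unit_ball: "bounded (closed_ball d 0 1)"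
proof -
  have "compact (sphere (0::'a) 1)" "sphere (0::'a) 1 \<noteq> {}" by auto
  then obtain p where p: "p \<in> sphere (0::'a) 1" "\<And>x. x \<in> sphere 0 1 \<Longrightarrow> d 0 p \<le> d 0 x"
    using continuous_attains_inf[of "sphere 0 1" "d 0"] continuous_on_subset[OF continuous_on_d_zero]
    by blast
  have "p \<noteq> 0" using p(1) by auto
  then have m: "d 0 p > 0" using mdist_pos_less[of 0 p] by simp
  \<comment> \<open>Half the minimum of \<open>d 0\<close> on the Euclidean unit sphere, so that the
    unit ball dilated by \<open>r\<close> misses that sphere.\<close>
  define r where "r = d 0 p / 2"
  have r: "r > 0" "r < d 0 p" using m by (auto simp: r_def)
  have "norm (dilation H \<iota> r x) \<le> 1" if x: "d 0 x \<le> 1" for x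
  proof (rule ccontr)
    let ?y = "dilation H \<iota> r x"
    assume "\<not> norm ?y \<le> 1"
    then have y: "norm ?y > 1" by simp
    define t where "t = 1 / norm ?y"
    have t: "0 \<le> t" "t \<le> 1" "t * norm ?y = 1"
      using y by (auto simp: t_def divide_le_eq)
    have "(1 - t) *\<^sub>R 0 + t *\<^sub>R x \<in> closed_ball d 0 1"
      using t x by (intro convexD[OF convex_ball]) (auto simp: in_closed_ball)
    then have "d 0 (t *\<^sub>R x) \<le> 1" by (simp add: in_closed_ball)
    then have "d 0 (dilation H \<iota> r (t *\<^sub>R x)) \<le> r"
      using d_dilation[OF r(1)] r(1) by (simp add: mult_left_le)
    then have "d 0 (t *\<^sub>R ?y) < d 0 p"
      using r by (simp add: linear_scale[OF linear_dilation])
    moreover have "t *\<^sub>R ?y \<in> sphere 0 1" using t by simp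
    ultimately show False using p(2) by fastforce
  qed
  \<comment> \<open>Undoing the dilation is a bounded linear map; its bound \<open>K\<close> is the
    final Euclidean radius.\<close>
  moreover obtain K where K: "\<And>y. norm (dilation H \<iota> (1 / r) y) \<le> norm y * K" "K > 0"
    using bounded_linear.pos_bounded[OF linear_conv_bounded_linear[THEN iffD1, OF linear_dilation]] by blast
  ultimately have "norm x \<le> K" if "d 0 x \<le> 1" for x
  proof -
    have "norm x = norm (dilation H \<iota> (1 / r) (dilation H \<iota> r x))"
      using dilation_inverse[OF r(1)] by simp
    also have "\<dots> \<le> norm (dilation H \<iota> r x) * K" by (rule K)
    also have "\<dots> \<le> 1 * K"
      using \<open>\<And>x. d 0 x \<le> 1 \<Longrightarrow> norm (dilation H \<iota> r x) \<le> 1\<close>[OF that] K(2)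
      by (intro mult_right_mono) auto
    finally show ?thesis by simp
  qed
  then show ?thesis unfolding bounded_iff by (intro exI[of _ K]) (simp add: in_closed_ball)
qed

section \<open>Comparison of an arbitrary section with the central one\<close>

lemma hausdorff_measure_ball_section_le:
  assumes N: "vertical_subgroup H \<iota> br N"
  shows "hausdorff_measure n (closed_ball d u 1 \<inter> N) \<le> hausdorff_measure n (N \<inter> closed_ball d 0 1)"
proof -
  let ?B = "closed_ball d 0 1"
  obtain l Nl where l: "l \<in> {1..\<iota>}" and Nl: "subspace Nl" "Nl \<subseteq> H l"
    and N_eq: "N = span (Nl \<union> (\<Union>j\<in>{l + 1..\<iota>}. H j))"
    using N by (auto simp: vertical_subgroup_def)
  \<comment> \<open>The layers of \<open>N\<close>: only the lowest one may be a proper subspace of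
    the corresponding layer of the group.\<close>
  define S where "S j = (if j = l then Nl else H j)" for j
  have "{l..\<iota>} = insert l {l + 1..\<iota>}" using l by auto
  then have US: "(\<Union>j\<in>{l..\<iota>}. S j) = Nl \<union> (\<Union>j\<in>{l + 1..\<iota>}. H j)"
    by (auto simp: S_def)
  obtain Bas rk where Bas: "orthonormal_system Bas" "span Bas = N"
    and rk: "\<And>b. b \<in> Bas \<Longrightarrow> rk b \<in> {1..\<iota>} \<and> b \<in> H (rk b)"
  proof (rule adapted_basis_exists[of "{l..\<iota>}" S])
    show "subspace (S j) \<and> S j \<subseteq> H j" if "j \<in> {l..\<iota>}" for j
      using that l Nl subspace_layer[of j] by (auto simp: S_def)
    show "{l..\<iota>} \<subseteq> {1..\<iota>}" using l by auto
  qed (use US N_eq in auto)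
  interpret orthonormal_system Bas by (rule Bas)
  have subN: "subspace N" using Bas(2) by auto
  have tail_N: "tail (l + 1) \<subseteq> N"
  proof -
    have "H i \<subseteq> N" if "i \<ge> l + 1" for i
    proof (cases "i \<le> \<iota>")
      case True
      then show ?thesis using that N_eq by (auto intro!: span_base)
    next
      case False
      then show ?thesis using layer_above[of i] subspace_0[OF subN] by simp
    qed
    then show ?thesis unfolding tail_def using subN by (intro span_minimal) auto
  qed
  have N_tail: "N \<subseteq> tail l"
  proof -
    have "Nl \<union> (\<Union>j\<in>{l + 1..\<iota>}. H j) \<subseteq> tail l"
    proof (intro Un_least UN_least)
      show "Nl \<subseteq> tail l" using Nl(2) layer_subset_tail[of l l] by (rule order_trans) simp
      show "H j \<subseteq> tail l" if "j \<in> {l + 1..\<iota>}" for j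
        using that by (intro layer_subset_tail) auto
    qed
    then show ?thesis unfolding N_eq using subspace_tail by (rule span_minimal)
  qed
  define \<psi> where "\<psi> x = bch \<iota> br u (x - u)" for x
  have \<psi>N: "\<psi> x \<in> N" if x: "x \<in> N" for x
  proof -
    \<comment> \<open>Compares the images of \<open>x - u\<close> and \<open>- u\<close> under left
      translation by \<open>u\<close>. They differ by \<open>x\<close>, which lies in
      \<open>tail l\<close>, up to \<open>tail (l + 1)\<close>, and the image of \<open>- u\<close>
      is \<open>0\<close>.\<close>
    have "\<psi> x - x \<in> tail (l + 1)"
      using bch_diff_in_tail[of l "x - u" "- u" u] x N_tail l bch_minus_right[of u]
      by (auto simp: \<psi>_def)
    then have "\<psi> x - x + x \<in> N" using tail_N x subspace_add[OF subN] by blast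
    then show ?thesis by simp
  qed
  have "continuous_on UNIV \<psi>"
    unfolding \<psi>_def by (rule continuous_on_compose2[OF continuous_on_bch]) (auto intro!: continuous_intros)
  then have \<psi>m [measurable]: "\<psi> \<in> borel_measurable borel"
    by (rule borel_measurable_continuous_onI)
  have \<psi>_triangular: "(\<psi> x - x) \<bullet> b = (\<psi> y - y) \<bullet> b"
    if b: "b \<in> Bas" and xy: "x \<in> span Bas" "y \<in> span Bas"
      and eq: "\<And>c. c \<in> Bas \<Longrightarrow> rk c < rk b \<Longrightarrow> x \<bullet> c = y \<bullet> c" for x y b
  proof -
    \<comment> \<open>Coordinates of rank below \<open>rk b\<close> cancel, so only basis vectors
      from layers of degree at least \<open>rk b\<close> enter the difference.\<close>
    have "x - y = combine (\<lambda>c. (x - y) \<bullet> c)"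
      using combine_of_inner[OF span_diff[OF xy]] by simp
    also have "\<dots> \<in> tail (rk b)"
      unfolding combine_def
    proof (rule subspace_sum[OF subspace_tail])
      fix c assume c: "c \<in> Bas"
      show "((x - y) \<bullet> c) *\<^sub>R c \<in> tail (rk b)"
      proof (cases "rk c < rk b")
        case True
        then show ?thesis using eq[OF c] subspace_0[OF subspace_tail] by (simp add: inner_diff_left)
      next
        case False
        then have "c \<in> tail (rk b)" using rk[OF c] layer_subset_tail[of "rk b" "rk c"] by auto
        then show ?thesis by (rule subspace_scale[OF subspace_tail])
      qed
    qed
    \<comment> \<open>The displacements of \<open>x\<close> and \<open>y\<close> differ only by an
      element of \<open>tail (rk b + 1)\<close>, which is orthogonal to \<open>b\<close>.\<close>
    finally have "\<psi> x - \<psi> y - (x - y) \<in> tail (rk b + 1)"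
      using bch_diff_in_tail[of "rk b" "x - u" "y - u" u] rk[OF b] by (simp add: \<psi>_def)
    then have "(\<psi> x - \<psi> y - (x - y)) \<bullet> b = 0"
      using rk[OF b] by (intro orthogonal_tail_layer) auto
    then show ?thesis by (simp add: inner_diff_left)
  qed
  have meas [measurable]: "closed_ball d v 1 \<in> sets borel" for v
    by (rule borel_closed) (rule closed_closed_ball)
  have N_meas [measurable]: "N \<in> sets borel" using closed_span_Bas Bas(2) by simp
  define A where "A = (\<lambda>x. x - u) -` ?B"
  have A [measurable]: "A \<in> sets borel"
    unfolding A_def using measurable_sets[of "\<lambda>x. x - u" borel borel ?B] meas by simp
  have A' [measurable]: "uminus -` A \<in> sets borel"
    using measurable_sets[of uminus borel borel A] A by simp
  \<comment> \<open>Left invariance: \<open>d u (bch \<iota> br u (x - u)) = d 0 (x - u)\<close>. No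
    restriction to \<open>N\<close> is made here; \<open>span_measure\<close> sees only the part
    inside \<open>N\<close>.\<close>
  have vim: "\<psi> -` closed_ball d u 1 = A"
    by (auto simp: A_def \<psi>_def in_closed_ball d_bch)
  have "emeasure span_measure (\<psi> -` closed_ball d u 1) = emeasure span_measure (closed_ball d u 1)"
  proof (rule emeasure_span_measure_triangular[of rk])
    show "\<psi> x \<in> span Bas" if "x \<in> span Bas" for x
      using that \<psi>N Bas(2) by simp
  qed (fact \<psi>_triangular \<psi>m meas)+
  then have "emeasure span_measure (closed_ball d u 1) = emeasure span_measure A"
    unfolding vim by (rule sym)
  also have "\<dots> \<le> emeasure span_measure ?B"
  proof (rule ccontr)
    assume "\<not> ?thesis"
    then have less: "emeasure span_measure ?B < emeasure span_measure A" by simp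
    have "emeasure span_measure A * emeasure span_measure (uminus -` A) \<le> (emeasure span_measure ?B)\<^sup>2"
    proof (rule brunn_minkowski_span_measure)
      fix x y assume "x \<in> A" "y \<in> uminus -` A"
      then have x: "x - u \<in> ?B" and "- (y + u) \<in> ?B"
        by (simp_all add: A_def)
      then have y: "y + u \<in> ?B"
        unfolding in_closed_ball d_zero_uminus by simp
      have "(1 / 2) *\<^sub>R (x - u) + (1 / 2) *\<^sub>R (y + u) \<in> ?B"
        by (rule convexD[OF convex_ball x y]) auto
      moreover have "(1 / 2) *\<^sub>R (x - u) + (1 / 2) *\<^sub>R (y + u) = (1 / 2) *\<^sub>R (x + y)"
        by (simp add: scaleR_add_right[symmetric])
      ultimately show "(1 / 2) *\<^sub>R (x + y) \<in> ?B" by simp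
    qed (fact meas A A')+
    then have sq: "emeasure span_measure A * emeasure span_measure A \<le> (emeasure span_measure ?B)\<^sup>2"
      using A by (simp add: emeasure_span_measure_uminus)
    \<comment> \<open>Strict monotonicity of multiplication in \<open>ennreal\<close> needs a
      positive finite factor. Here it is the measure of the unit ball, positive as a neighbourhood
      of \<open>0\<close> and finite by boundedness.\<close>
    obtain e where e: "e > 0" "ball 0 e \<subseteq> ?B" by (rule unit_ball_neighbourhood)
    then have "emeasure span_measure ?B > 0"
      using meas by (intro emeasure_span_measure_pos[of _ e]) auto
    moreover have "emeasure span_measure ?B < top"
      using emeasure_span_measure_bounded[OF meas bounded_unit_ball] by simp
    ultimately have "emeasure span_measure ?B * emeasure span_measure ?B
        < emeasure span_measure ?B * emeasure span_measure A"
      using less by (intro ennreal_mult_strict_left_mono)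
    also have "\<dots> \<le> emeasure span_measure A * emeasure span_measure A"
      using less by (intro mult_right_mono) auto
    finally show False using sq by (simp add: power2_eq_square)
  qed
  finally have "emeasure span_measure (closed_ball d u 1) \<le> emeasure span_measure ?B" .
  moreover have "emeasure span_measure (D \<inter> N) = emeasure span_measure D" if "D \<in> sets borel" for D
    using AE_span_measure Bas(2) that N_meas by (intro emeasure_eq_AE) auto
  ultimately have le: "emeasure span_measure (closed_ball d u 1 \<inter> N) \<le> emeasure span_measure (N \<inter> ?B)"
    unfolding Int_commute[of N ?B] by (simp only: meas)
  obtain e where e: "e > 0" "ball 0 e \<subseteq> ?B" by (rule unit_ball_neighbourhood)
  show ?thesis
  proof (rule hausdorff_measure_le_of_span_measure_le[OF _ _ _ _ _ _ e(1) _ le])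
    show "bounded (N \<inter> ?B)" by (rule bounded_subset[OF bounded_unit_ball]) simp
    show "- x \<in> N \<inter> ?B" if "x \<in> N \<inter> ?B" for x
      using that subspace_neg[OF subN] by (auto simp: in_closed_ball d_zero_uminus)
    show "x \<in> N \<inter> ?B" if "x \<in> span Bas" "norm x < e" for x
      using that e(2) Bas(2) by auto
    show "closed_ball d u 1 \<inter> N \<in> sets borel" "N \<inter> ?B \<in> sets borel"
      by measurable
    show "closed_ball d u 1 \<inter> N \<subseteq> span Bas" "N \<inter> ?B \<subseteq> span Bas"
      using Bas(2) by simp_all
  qed
qed

end

theorem theorem1p2:
  fixes H :: "nat \<Rightarrow> 'a::euclidean_space set" and \<iota> n :: nat
    and br :: "'a \<Rightarrow> 'a \<Rightarrow> 'a" and d :: "'a \<Rightarrow> 'a \<Rightarrow> real" and N :: "'a set"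
  assumes "homogeneous_group H \<iota> br"
    and "homogeneous_distance H \<iota> br d"
    and "convex (closed_ball d 0 1)"
    and "vertical_subgroup H \<iota> br N"
    and "dim N = n" and "n \<ge> 1"
  shows "spherical_factor d N = hausdorff_measure n (N \<inter> closed_ball d 0 1)"
proof -
  interpret homogeneous_distance H \<iota> br d by fact
  interpret convex_homogeneous_distance H \<iota> br d by standard fact
  show ?thesis
    unfolding spherical_factor_def assms(5)
  proof (rule Greatest_equality)
    \<comment> \<open>\<open>GREATEST\<close> requires the value to be attained; the centre
      \<open>0\<close> attains it.\<close>
    show "\<exists>u. d u 0 \<le> 1 \<and> hausdorff_measure n (N \<inter> closed_ball d 0 1)
        = hausdorff_measure n (closed_ball d u 1 \<inter> N)"
      by (rule exI[of _ 0]) (simp add: Int_commute)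
    show "m \<le> hausdorff_measure n (N \<inter> closed_ball d 0 1)"
      if "\<exists>u. d u 0 \<le> 1 \<and> m = hausdorff_measure n (closed_ball d u 1 \<inter> N)" for m
      using that hausdorff_measure_ball_section_le[OF assms(4)] by auto
  qed
qed

end
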